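(* Let $d \ge 2$ and $k \ge 1$ be fixed integers, let $f$ be a bounded Lebesgue-measurable probability density function on $\mathbb{R}^d$, and let $r = r_n$ be a sequence of positive reals with $r = o(n^{-1/d})$. (1) If $r = o\left(n^{-\frac{k+2}{d(k+1)}}\right)$, then a.a.s. $H_k(C(X_n;r)) = 0$. (2) If $r = \omega\left(n^{-\frac{k+2}{d(k+1)}}\right)$, then a.a.s. $H_k(C(X_n;r)) \neq 0$.
   Context: Let $x_1, x_2, \ldots$ be i.i.d. random points in $\mathbb{R}^d$ with common density $f$, and let $X_n = \{x_1, \ldots, x_n\}$. For $r>0$, the random Čech complex $C(X_n;r)$ is the simplicial complex with vertex set $X_n$ in which a set $\sigma \subseteq X_n$ is a face iff $\bigcap_{x_i \in \sigma} B(x_i, r/2) \neq \emptyset$, where $B(p,s)$ is the closed Euclidean ball of radius $s$ centered at $p$. Homology $H_k$ is simplicial homology with coefficients in an arbitrary fixed field. A property holds asymptotically almost surely (a.a.s.) if its probability tends to $1$ as $n \to \infty$. For non-negative sequences, $g = o(h)$ means that for every $\epsilon>0$, $g(n) \le \epsilon h(n)$ for all large $n$; $g = \omega(h)$ means that for every $M>0$, $g(n) \ge M h(n)$ for all large $n$.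
   Formalization: Part (2) is stated only for 1 ≤ k ≤ d−1; for k ≥ d it is false, since by the nerve theorem C(X_n;r) is homotopy equivalent to a union of balls in R^d and so H_k = 0 always (e.g. d = k = 2, r = n^{-7/12}). Part (1) is kept for all k ≥ 1. *)

theory Defs
  imports
    "HOL-Probability.Probability"
    "HOL-Library.Landau_Symbols"
    "HOL-Combinatorics.Permutations"
    "HOL-Algebra.Elementary_Groups"
begin

section \<open>Simplicial homology with field coefficients\<close>

text \<open>Only nonempty faces are listed; the empty face plays no role in (unreduced) homology.\<close>

definition abstract_simplicial_complex :: "'v set set \<Rightarrow> bool" where
  "abstract_simplicial_complex K \<longleftrightarrow>
     (\<forall>\<sigma>\<in>K. finite \<sigma> \<and> \<sigma> \<noteq> {} \<and> (\<forall>\<tau>. \<tau> \<noteq> {} \<longrightarrow> \<tau> \<subseteq> \<sigma> \<longrightarrow> \<tau> \<in> K))"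

text \<open>
  Oriented chains. The value \<open>c [v\<^sub>0, \<dots>, v\<^sub>k]\<close> is the coefficient in \<open>c\<close> of the oriented
  \<open>k\<close>-simplex \<open>[v\<^sub>0, \<dots>, v\<^sub>k]\<close>; a permutation of the vertices multiplies it by its sign, and it
  vanishes on tuples that are not enumerations without repetition of a \<open>k\<close>-face.
\<close>

definition simplicial_chains :: "'v set set \<Rightarrow> nat \<Rightarrow> ('v list \<Rightarrow> 'f::field) set" where
  "simplicial_chains K k = {c. finite {xs. c xs \<noteq> 0} \<and>
     (\<forall>xs. c xs \<noteq> 0 \<longrightarrow> distinct xs \<and> length xs = Suc k \<and> set xs \<in> K) \<and>
     (\<forall>xs p. p permutes {..<length xs} \<longrightarrow> c (permute_list p xs) = of_int (sign p) * c xs)}"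

text \<open>
  The usual boundary \<open>\<partial>[v\<^sub>0, \<dots>, v\<^sub>k] = \<Sum>\<^sub>i (-1)\<^sup>i [v\<^sub>0, \<dots>, v\<^sub>i\<^sub>-\<^sub>1, v\<^sub>i\<^sub>+\<^sub>1, \<dots>, v\<^sub>k]\<close>, read off on
  coefficients: an oriented simplex \<open>[ys]\<close> occurs with coefficient \<open>+1\<close> in the boundary of each
  \<open>[v, ys]\<close>. The case \<open>ys = []\<close> makes the boundary of a \<open>0\<close>-chain zero (no augmentation).
\<close>

definition boundary :: "('v list \<Rightarrow> 'f::field) \<Rightarrow> ('v list \<Rightarrow> 'f)" where
  "boundary c ys = (if ys = [] then 0 else (\<Sum>v | c (v # ys) \<noteq> 0. c (v # ys)))"

definition cycles :: "'v set set \<Rightarrow> nat \<Rightarrow> ('v list \<Rightarrow> 'f::field) set" where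
  "cycles K k = {c \<in> simplicial_chains K k. boundary c = (\<lambda>_. 0)}"

definition boundaries :: "'v set set \<Rightarrow> nat \<Rightarrow> ('v list \<Rightarrow> 'f::field) set" where
  "boundaries K k = boundary ` simplicial_chains K (Suc k)"

definition cycle_group :: "'v set set \<Rightarrow> nat \<Rightarrow> ('v list \<Rightarrow> 'f::field) monoid" where
  "cycle_group K k = \<lparr>carrier = cycles K k, mult = (\<lambda>c c' xs. c xs + c' xs), one = (\<lambda>_. 0)\<rparr>"

text \<open>
  The \<open>k\<close>-th homology is the quotient of \<open>k\<close>-cycles by \<open>k\<close>-boundaries, presented through its
  additive group; as a vector space it is zero iff this group is trivial.
\<close>

definition simplicial_homology :: "'v set set \<Rightarrow> nat \<Rightarrow> ('v list \<Rightarrow> 'f::field) set monoid" where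
  "simplicial_homology K k = cycle_group K k Mod boundaries K k"


section \<open>The random Cech complex\<close>

definition cech_complex :: "'a::metric_space set \<Rightarrow> real \<Rightarrow> 'a set set" where
  "cech_complex X r =
     {\<sigma>. finite \<sigma> \<and> \<sigma> \<noteq> {} \<and> \<sigma> \<subseteq> X \<and> (\<Inter>p\<in>\<sigma>. cball p (r / 2)) \<noteq> {}}"

text \<open>
  \<^const>\<open>distributed\<close> with respect to \<^const>\<open>lborel\<close> would force a Borel density; here
  the density is only Lebesgue measurable, while random vectors are, as usual, measurable
  with respect to the Borel sets.
\<close>

definition has_lebesgue_density ::
  "'w measure \<Rightarrow> ('w \<Rightarrow> 'a::euclidean_space) \<Rightarrow> ('a \<Rightarrow> real) \<Rightarrow> bool" where
  "has_lebesgue_density M X f \<longleftrightarrow>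
     X \<in> borel_measurable M \<and> f \<in> borel_measurable lebesgue \<and>
     (\<forall>A\<in>sets borel. emeasure (distr M borel X) A = emeasure (density lebesgue f) A)"

text \<open>
  Since \<^const>\<open>measure\<close> is \<open>0\<close> on non-measurable sets, the limit \<open>1\<close> includes that the events
  are measurable for all large \<open>n\<close>.
\<close>

definition aas :: "'w measure \<Rightarrow> (nat \<Rightarrow> 'w \<Rightarrow> bool) \<Rightarrow> bool" where
  "aas M E \<longleftrightarrow> (\<lambda>n. measure M {\<omega> \<in> space M. E n \<omega>}) \<longlonglongrightarrow> 1"


section \<open>Well-definedness\<close>

lemma abstract_simplicial_complex_cech: "abstract_simplicial_complex (cech_complex X r)"
proof -
  have "\<tau> \<in> cech_complex X r"
    if "\<sigma> \<in> cech_complex X r" "\<tau> \<noteq> {}" "\<tau> \<subseteq> \<sigma>" for \<sigma> \<tau>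
  proof -
    have "(\<Inter>p\<in>\<sigma>. cball p (r / 2)) \<subseteq> (\<Inter>p\<in>\<tau>. cball p (r / 2))"
      using that(3) by blast
    then show ?thesis
      using that finite_subset[of \<tau> \<sigma>] unfolding cech_complex_def by blast
  qed
  moreover have "finite \<sigma>" "\<sigma> \<noteq> {}" if "\<sigma> \<in> cech_complex X r" for \<sigma>
    using that unfolding cech_complex_def by blast+
  ultimately show ?thesis
    unfolding abstract_simplicial_complex_def by blast
qed

lemma boundary_eq_sum:
  assumes "finite S" "{v. c (v # ys) \<noteq> 0} \<subseteq> S"
  shows "boundary c ys = (if ys = [] then 0 else (\<Sum>v\<in>S. c (v # ys)))"
proof -
  have "(\<Sum>v | c (v # ys) \<noteq> 0. c (v # ys)) = (\<Sum>v\<in>S. c (v # ys))"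
    by (rule sum.mono_neutral_left) (use assms in auto)
  then show ?thesis by (simp add: boundary_def)
qed

lemma chains_vertices:
  assumes "c \<in> simplicial_chains K k"
  shows "\<exists>S. finite S \<and> (\<forall>xs. c xs \<noteq> 0 \<longrightarrow> set xs \<subseteq> S)"
proof (intro exI conjI)
  show "finite (\<Union>xs\<in>{xs. c xs \<noteq> 0}. set xs)"
    using assms by (auto simp: simplicial_chains_def)
qed auto

lemma permute_list_Cons:
  assumes "p permutes {..<length ys}"
  defines "q \<equiv> map_permutation {..<length ys} Suc p"
  shows "permute_list q (v # ys) = v # permute_list p ys"
    and "q permutes {..<length (v # ys)}" and "sign q = sign p"
proof -
  have q: "q permutes Suc ` {..<length ys}"
    unfolding q_def by (rule map_permutation_permutes[OF _ assms(1)]) (simp add: bij_betw_def)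
  then show perm: "q permutes {..<length (v # ys)}"
    by (rule permutes_subset) auto
  show "sign q = sign p"
    unfolding q_def by (rule sign_map_permutation) (use assms in auto)
  have q0: "q 0 = 0" by (rule permutes_not_in[OF q]) auto
  have qS: "q (Suc i) = Suc (p i)" if "i < length ys" for i
    unfolding q_def by (rule map_permutation_apply) (use that in auto)
  show "permute_list q (v # ys) = v # permute_list p ys"
  proof (rule nth_equalityI)
    fix i assume "i < length (permute_list q (v # ys))"
    then show "permute_list q (v # ys) ! i = (v # permute_list p ys) ! i"
      by (cases i) (simp_all add: permute_list_nth[OF perm] permute_list_nth[OF assms(1)] q0 qS)
  qed simp
qed

lemma chains_swap:
  assumes "c \<in> simplicial_chains K k"
  shows "c (w # v # ys) = - c (v # w # ys)"
proof -
  let ?t = "Transposition.transpose 0 (1::nat)"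
  let ?xs = "v # w # ys"
  have perm: "?t permutes {..<length ?xs}"
    by (rule permutes_swap_id) auto
  have "permute_list ?t ?xs = w # v # ys"
  proof (rule nth_equalityI)
    fix i assume "i < length (permute_list ?t ?xs)"
    then have i: "i < length ?xs" by simp
    show "permute_list ?t ?xs ! i = (w # v # ys) ! i"
      using permute_list_nth[OF perm i]
      by (cases "i = 0 \<or> i = 1") (auto simp: nth_Cons' transpose_def)
  qed simp
  moreover have "sign ?t = - 1" by (simp add: sign_swap_id)
  ultimately show ?thesis
    using assms perm unfolding simplicial_chains_def by fastforce
qed

lemma sum_alternating:
  fixes T :: "'v \<Rightarrow> 'v \<Rightarrow> 'f::field"
  assumes "finite S" "\<And>v. T v v = 0" "\<And>v w. T v w = - T w v"
  shows "(\<Sum>v\<in>S. \<Sum>w\<in>S. T v w) = 0"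
  using assms(1)
proof (induction S rule: finite_induct)
  case (insert a S)
  have "(\<Sum>w\<in>S. T a w) = - (\<Sum>v\<in>S. T v a)"
    by (subst assms(3)) (simp add: sum_negf)
  then show ?case
    using insert assms(2) by (simp add: sum.distrib)
qed simp

lemma boundary_boundary:
  assumes "c \<in> simplicial_chains K k"
  shows "boundary (boundary c) = (\<lambda>_. 0)"
proof
  fix ys :: "'a list"
  obtain S where S: "finite S" "\<And>xs. c xs \<noteq> 0 \<Longrightarrow> set xs \<subseteq> S"
    using chains_vertices[OF assms] by blast
  have b: "boundary c zs = (if zs = [] then 0 else (\<Sum>v\<in>S. c (v # zs)))" for zs
    by (rule boundary_eq_sum) (use S in force)+
  have "{w. boundary c (w # ys) \<noteq> 0} \<subseteq> S"
  proof
    fix w assume "w \<in> {w. boundary c (w # ys) \<noteq> 0}"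
    then obtain v where "c (v # w # ys) \<noteq> 0"
      by (auto simp: b split: if_splits elim: sum.not_neutral_contains_not_neutral)
    then show "w \<in> S" using S(2) by fastforce
  qed
  then have "boundary (boundary c) ys =
      (if ys = [] then 0 else (\<Sum>w\<in>S. \<Sum>v\<in>S. c (v # w # ys)))"
    by (subst boundary_eq_sum[OF S(1)]) (simp_all add: b)
  moreover have "(\<Sum>w\<in>S. \<Sum>v\<in>S. c (v # w # ys)) = 0"
  proof (rule sum_alternating[OF S(1)])
    show "c (v # v # ys) = 0" for v using assms by (force simp: simplicial_chains_def)
  qed (rule chains_swap[OF assms])
  ultimately show "boundary (boundary c) ys = 0" by simp
qed

lemma boundary_chains:
  assumes K: "abstract_simplicial_complex K" and c: "c \<in> simplicial_chains K (Suc k)"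
  shows "boundary c \<in> simplicial_chains K k"
proof -
  obtain S where S: "finite S" "\<And>xs. c xs \<noteq> 0 \<Longrightarrow> set xs \<subseteq> S"
    using chains_vertices[OF c] by blast
  have b: "boundary c zs = (if zs = [] then 0 else (\<Sum>v\<in>S. c (v # zs)))" for zs
    by (rule boundary_eq_sum) (use S in force)+
  have nz: "\<exists>v. c (v # ys) \<noteq> 0 \<and> ys \<noteq> []" if "boundary c ys \<noteq> 0" for ys
    using that by (auto simp: b split: if_splits elim: sum.not_neutral_contains_not_neutral)
  have "{ys. boundary c ys \<noteq> 0} \<subseteq> tl ` {xs. c xs \<noteq> 0}"
    using nz by (force simp: image_iff)
  then have "finite {ys. boundary c ys \<noteq> 0}"
    by (rule finite_subset) (use c in \<open>auto simp: simplicial_chains_def\<close>)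
  moreover have "distinct ys \<and> length ys = Suc k \<and> set ys \<in> K" if ys: "boundary c ys \<noteq> 0" for ys
  proof -
    obtain v where v: "c (v # ys) \<noteq> 0" "ys \<noteq> []" using nz[OF ys] by blast
    then have "distinct (v # ys) \<and> length (v # ys) = Suc (Suc k) \<and> set (v # ys) \<in> K"
      using c unfolding simplicial_chains_def by blast
    moreover have "set ys \<in> K" if "set (v # ys) \<in> K"
      using K that v(2) unfolding abstract_simplicial_complex_def
      by (metis set_empty set_subset_Cons)
    ultimately show ?thesis by simp
  qed
  moreover have "boundary c (permute_list p ys) = of_int (sign p) * boundary c ys"
    if p: "p permutes {..<length ys}" for p ys
  proof -
    have "c (v # permute_list p ys) = of_int (sign p) * c (v # ys)" for v
    proof -
      let ?q = "map_permutation {..<length ys} Suc p"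
      have "c (permute_list ?q (v # ys)) = of_int (sign ?q) * c (v # ys)"
        using c permute_list_Cons(2)[OF p, of v] unfolding simplicial_chains_def by blast
      then show ?thesis
        by (simp only: permute_list_Cons(1,3)[OF p])
    qed
    moreover have "permute_list p ys = [] \<longleftrightarrow> ys = []"
      by (metis length_permute_list length_0_conv)
    ultimately show ?thesis by (simp add: b sum_distrib_left)
  qed
  ultimately show ?thesis by (simp add: simplicial_chains_def)
qed

lemma zero_chains: "(\<lambda>_. 0) \<in> simplicial_chains K k"
  by (simp add: simplicial_chains_def)

lemma add_chains:
  assumes "a \<in> simplicial_chains K k" "b \<in> simplicial_chains K k"
  shows "(\<lambda>xs. a xs + b xs) \<in> simplicial_chains K k"
proof -
  have "finite {xs. a xs + b xs \<noteq> 0}"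
    by (rule finite_subset[of _ "{xs. a xs \<noteq> 0} \<union> {xs. b xs \<noteq> 0}"])
      (use assms in \<open>auto simp: simplicial_chains_def\<close>)
  moreover have "a xs \<noteq> 0 \<or> b xs \<noteq> 0" if "a xs + b xs \<noteq> 0" for xs using that by auto
  ultimately show ?thesis
    using assms unfolding simplicial_chains_def by (simp add: distrib_left) blast
qed

lemma scale_chains:
  assumes "a \<in> simplicial_chains K k"
  shows "(\<lambda>xs. s * a xs) \<in> simplicial_chains K k"
proof -
  have "finite {xs. s * a xs \<noteq> 0}"
    by (rule finite_subset[of _ "{xs. a xs \<noteq> 0}"]) (use assms in \<open>auto simp: simplicial_chains_def\<close>)
  then show ?thesis
    using assms unfolding simplicial_chains_def by (simp add: mult.left_commute)
qed

lemma boundary_add: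
  assumes "a \<in> simplicial_chains K k" "b \<in> simplicial_chains K k"
  shows "boundary (\<lambda>xs. a xs + b xs) = (\<lambda>xs. boundary a xs + boundary b xs)"
proof
  fix ys
  obtain S where S: "finite S" "\<And>xs. a xs \<noteq> 0 \<Longrightarrow> set xs \<subseteq> S"
    using chains_vertices[OF assms(1)] by blast
  obtain T where T: "finite T" "\<And>xs. b xs \<noteq> 0 \<Longrightarrow> set xs \<subseteq> T"
    using chains_vertices[OF assms(2)] by blast
  have fin: "finite (S \<union> T)" using S T by simp
  have nz: "a xs \<noteq> 0 \<or> b xs \<noteq> 0" if "a xs + b xs \<noteq> 0" for xs using that by auto
  have "{v. a (v # ys) \<noteq> 0} \<subseteq> S \<union> T" "{v. b (v # ys) \<noteq> 0} \<subseteq> S \<union> T"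
    using S(2) T(2) by force+
  moreover from this have "{v. a (v # ys) + b (v # ys) \<noteq> 0} \<subseteq> S \<union> T"
    using nz by blast
  ultimately show "boundary (\<lambda>xs. a xs + b xs) ys = boundary a ys + boundary b ys"
    using boundary_eq_sum[OF fin, of a ys] boundary_eq_sum[OF fin, of b ys]
      boundary_eq_sum[OF fin, of "\<lambda>xs. a xs + b xs" ys]
    by (simp add: sum.distrib)
qed

lemma boundary_scale: "boundary (\<lambda>xs. s * a xs) = (\<lambda>xs. s * boundary a xs)"
  by (rule ext) (cases "s = 0"; simp add: boundary_def sum_distrib_left)

lemma boundaries_subset_cycles:
  "abstract_simplicial_complex K \<Longrightarrow> boundaries K k \<subseteq> cycles K k"
  unfolding boundaries_def cycles_def using boundary_chains boundary_boundary by blast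

lemma cycles_add:
  "a \<in> cycles K k \<Longrightarrow> b \<in> cycles K k \<Longrightarrow> (\<lambda>xs. a xs + b xs) \<in> cycles K k"
  by (auto simp: cycles_def add_chains boundary_add)

lemma cycles_scale: "a \<in> cycles K k \<Longrightarrow> (\<lambda>xs. s * a xs) \<in> cycles K k"
  by (auto simp: cycles_def scale_chains boundary_scale)

lemma cycles_zero: "(\<lambda>_. 0) \<in> cycles K k"
  by (simp add: cycles_def zero_chains boundary_def fun_eq_iff)

lemma comm_group_cycle_group: "comm_group (cycle_group K k :: ('v list \<Rightarrow> 'f::field) monoid)"
proof (rule comm_groupI)
  fix a assume "a \<in> carrier (cycle_group K k :: ('v list \<Rightarrow> 'f) monoid)"
  then have "(\<lambda>xs. - 1 * a xs) \<in> cycles K k"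
    by (intro cycles_scale) (simp add: cycle_group_def)
  then show "\<exists>b\<in>carrier (cycle_group K k). b \<otimes>\<^bsub>cycle_group K k\<^esub> a = \<one>\<^bsub>cycle_group K k\<^esub>"
    by (intro bexI[of _ "\<lambda>xs. - 1 * a xs"]) (simp_all add: cycle_group_def)
qed (auto simp: cycle_group_def cycles_add cycles_zero add.assoc add.commute)

lemma subgroup_boundaries:
  assumes "abstract_simplicial_complex K"
  shows "subgroup (boundaries K k) (cycle_group K k :: ('v list \<Rightarrow> 'f::field) monoid)"
proof -
  interpret comm_group "cycle_group K k :: ('v list \<Rightarrow> 'f) monoid"
    by (rule comm_group_cycle_group)
  have inv: "inv\<^bsub>cycle_group K k\<^esub> a = (\<lambda>xs. - 1 * a xs)" if "a \<in> cycles K k" for a :: "'v list \<Rightarrow> 'f"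
    by (rule inv_equality) (use that cycles_scale[OF that, of "- 1"] in \<open>auto simp: cycle_group_def\<close>)
  show ?thesis
  proof (rule subgroupI)
    show sub: "boundaries K k \<subseteq> carrier (cycle_group K k)"
      using boundaries_subset_cycles[OF assms] by (simp add: cycle_group_def)
    show "boundaries K k \<noteq> {}"
      using zero_chains by (auto simp: boundaries_def)
    show "inv\<^bsub>cycle_group K k\<^esub> a \<in> boundaries K k" if "a \<in> boundaries K k" for a :: "'v list \<Rightarrow> 'f"
    proof -
      have "a \<in> cycles K k" using that boundaries_subset_cycles[OF assms] by blast
      moreover have "(\<lambda>xs. - 1 * a xs) \<in> boundaries K k"
        using that boundary_scale[of "- 1", symmetric] scale_chains[of _ K "Suc k" "- 1"]
        unfolding boundaries_def by (auto simp del: mult_minus1)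
      ultimately show ?thesis using inv by simp
    qed
    show "a \<otimes>\<^bsub>cycle_group K k\<^esub> b \<in> boundaries K k"
      if ab: "a \<in> boundaries K k" "b \<in> boundaries K k" for a b :: "'v list \<Rightarrow> 'f"
    proof -
      from ab obtain a' b' where "a = boundary a'" "b = boundary b'"
        "a' \<in> simplicial_chains K (Suc k)" "b' \<in> simplicial_chains K (Suc k)"
        by (auto simp: boundaries_def)
      then show ?thesis
        unfolding boundaries_def cycle_group_def
        by (auto simp: boundary_add[symmetric] intro!: imageI add_chains)
    qed
  qed
qed

lemma comm_group_simplicial_homology:
  assumes "abstract_simplicial_complex K"
  shows "comm_group (simplicial_homology K k :: ('v list \<Rightarrow> 'f::field) set monoid)"
  unfolding simplicial_homology_def
  by (rule comm_group.abelian_FactGroup[OF comm_group_cycle_group subgroup_boundaries[OF assms]])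

lemma trivial_simplicial_homology_iff:
  assumes "abstract_simplicial_complex K"
  shows "trivial_group (simplicial_homology K k :: ('v list \<Rightarrow> 'f::field) set monoid) \<longleftrightarrow>
         (cycles K k :: ('v list \<Rightarrow> 'f) set) = boundaries K k"
proof -
  interpret C: comm_group "cycle_group K k :: ('v list \<Rightarrow> 'f) monoid"
    by (rule comm_group_cycle_group)
  have sub: "subgroup (boundaries K k) (cycle_group K k :: ('v list \<Rightarrow> 'f) monoid)"
    by (rule subgroup_boundaries[OF assms])
  have "group (simplicial_homology K k :: ('v list \<Rightarrow> 'f) set monoid)"
    using comm_group_simplicial_homology[OF assms] by (rule comm_group.axioms(2))
  then have "trivial_group (simplicial_homology K k :: ('v list \<Rightarrow> 'f) set monoid) \<longleftrightarrow>
      (\<forall>c\<in>cycles K k. boundaries K k #>\<^bsub>cycle_group K k\<^esub> c = (boundaries K k :: ('v list \<Rightarrow> 'f) set))"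
    by (auto simp: group.trivial_group_subset simplicial_homology_def FactGroup_def RCOSETS_def
        cycle_group_def)
  also have "\<dots> \<longleftrightarrow> (\<forall>c\<in>cycles K k. c \<in> (boundaries K k :: ('v list \<Rightarrow> 'f) set))"
  proof (rule ball_cong[OF refl])
    fix c :: "'v list \<Rightarrow> 'f" assume "c \<in> cycles K k"
    then have c: "c \<in> carrier (cycle_group K k)" by (simp add: cycle_group_def)
    show "(boundaries K k #>\<^bsub>cycle_group K k\<^esub> c = (boundaries K k :: ('v list \<Rightarrow> 'f) set)) \<longleftrightarrow>
        c \<in> boundaries K k"
      using C.coset_join1[OF _ c sub] C.coset_join2[OF c sub]
        C.rcos_self[OF c sub] by auto
  qed
  also have "\<dots> \<longleftrightarrow> (cycles K k :: ('v list \<Rightarrow> 'f) set) = boundaries K k"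
    using boundaries_subset_cycles[OF assms] by blast
  finally show ?thesis .
qed

end

theory Submission
  imports Defs
begin

text \<open>
  Write \<open>m = n\<^sup>k\<^sup>+\<^sup>2 r\<^sup>d\<^sup>(\<^sup>k\<^sup>+\<^sup>1\<^sup>)\<close>; up to constants this is the expected number of \<open>(k + 2)\<close>-tuples of
  sample points of diameter of order \<open>r\<close>. The two growth conditions on \<open>r\<close> say that \<open>m\<close> tends to \<open>0\<close>
  or to infinity.

  A nonzero \<open>k\<close>-cycle with \<open>k \<ge> 1\<close> forces \<open>k + 2\<close> points within \<open>r\<close> of one of them
  (\<open>nontrivial_homology_crowded\<close>). If \<open>m\<close> tends to \<open>0\<close>, the union bound \<open>prob_nontrivial_le\<close> shows
  that such points do not exist asymptotically almost surely, so all cycles vanish.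

  If \<open>m\<close> tends to infinity, one looks for \<open>k + 2\<close> points that span the boundary of a simplex but not
  the simplex itself, with no other sample point nearby. Such a sphere cannot be filled, because one
  of its facets is a maximal face (\<open>isolated_hollow_simplex_homology\<close>). In dimension at least
  \<open>k + 1\<close> there is a configuration of this kind that tolerates perturbations
  (\<open>stable_hollow_simplex\<close>), so it is enough to find one sample point in each of \<open>k + 2\<close> prescribed
  small cubes. The number of such patterns has mean at least of order \<open>m\<close> and a variance bounded by
  a constant times its mean; the mean number of patterns disturbed by a further point is smaller by a
  factor of order \<open>n r\<^sup>d\<close>, which tends to \<open>0\<close>. Hence undisturbed patterns exist asymptotically almost surely
  (\<open>isolated_pattern_likely\<close>).

  The lower bound on the mean has to cope with a density that is merely measurable. Rounding to a
  cubical lattice turns it into a counting problem: a set of positive measure on which \<open>f\<close> exceeds a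
  positive constant contains a part of comparable measure such that most of the cubes near that part
  are at least half filled by the set (\<open>many_full_cells\<close>). The lattice also replaces conditioning in the upper bound.

  The events themselves are measurable since the homology depends only on a finite pattern of
  coincidences of points and intersections of balls (\<open>sets_trivial_homology\<close>).
\<close>

section \<open>Homology under relabelling of the vertices\<close>

lemma chains_supportD:
  assumes "c \<in> simplicial_chains K k" "c xs \<noteq> 0"
  shows "distinct xs" "length xs = Suc k" "set xs \<in> K"
  using assms by (auto simp: simplicial_chains_def)

text \<open>
  The pullback of a chain along the vertex map \<open>g\<close>. Outside \<open>V\<close> the map \<open>g\<close> is arbitrary and
  could hit vertices again, so the value there has to be forced to \<open>0\<close>.
\<close>

definition relabel_chain :: "('v \<Rightarrow> 'w) \<Rightarrow> 'v set \<Rightarrow> ('w list \<Rightarrow> 'f::field) \<Rightarrow> 'v list \<Rightarrow> 'f" where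
  "relabel_chain g V c xs = (if set xs \<subseteq> V then c (map g xs) else 0)"

context
  fixes g :: "'v \<Rightarrow> 'w" and V :: "'v set" and V' :: "'w set" and K K'
  assumes bij: "bij_betw g V V'"
    and faces: "\<And>\<sigma>. \<sigma> \<subseteq> V \<Longrightarrow> \<sigma> \<in> K \<longleftrightarrow> g ` \<sigma> \<in> K'"
    and K': "\<And>\<sigma>. \<sigma> \<in> K' \<Longrightarrow> \<sigma> \<subseteq> V'"
begin

lemma relabel_chain_chains:
  assumes c: "c \<in> simplicial_chains K' k"
  shows "relabel_chain g V c \<in> simplicial_chains K k"
proof -
  have inj: "inj_on g V" using bij by (simp add: bij_betw_def)
  have "{xs. relabel_chain g V c xs \<noteq> 0} \<subseteq> map (inv_into V g) ` {ys. c ys \<noteq> 0}"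
  proof
    fix xs assume "xs \<in> {xs. relabel_chain g V c xs \<noteq> 0}"
    then have *: "set xs \<subseteq> V" "c (map g xs) \<noteq> 0"
      by (auto simp: relabel_chain_def split: if_splits)
    have "map (inv_into V g) (map g xs) = xs"
      using *(1) inj by (simp add: map_idI subset_iff)
    then show "xs \<in> map (inv_into V g) ` {ys. c ys \<noteq> 0}"
      using *(2) by (metis (mono_tags, lifting) imageI mem_Collect_eq)
  qed
  then have "finite {xs. relabel_chain g V c xs \<noteq> 0}"
    by (rule finite_subset) (use c in \<open>auto simp: simplicial_chains_def\<close>)
  moreover have "distinct xs \<and> length xs = Suc k \<and> set xs \<in> K"
    if "relabel_chain g V c xs \<noteq> 0" for xs
  proof -
    from that have *: "set xs \<subseteq> V" "c (map g xs) \<noteq> 0"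
      by (auto simp: relabel_chain_def split: if_splits)
    then show ?thesis
      using chains_supportD[OF c *(2)] faces[OF *(1)] by (simp add: distinct_map)
  qed
  moreover have "relabel_chain g V c (permute_list p xs) = of_int (sign p) * relabel_chain g V c xs"
    if p: "p permutes {..<length xs}" for p xs
  proof -
    have "c (permute_list p (map g xs)) = of_int (sign p) * c (map g xs)"
      using c p unfolding simplicial_chains_def by simp
    then show ?thesis
      using p by (simp add: relabel_chain_def permute_list_map)
  qed
  ultimately show ?thesis by (simp add: simplicial_chains_def)
qed

lemma boundary_relabel_chain:
  assumes c: "c \<in> simplicial_chains K' k"
  shows "boundary (relabel_chain g V c) = relabel_chain g V (boundary c)"
proof
  fix ys
  have inj: "inj_on g V" and im: "g ` V = V'" using bij by (simp_all add: bij_betw_def)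
  show "boundary (relabel_chain g V c) ys = relabel_chain g V (boundary c) ys"
  proof (cases "ys \<noteq> [] \<and> set ys \<subseteq> V")
    case True
    have "(\<Sum>v | relabel_chain g V c (v # ys) \<noteq> 0. relabel_chain g V c (v # ys))
        = (\<Sum>w | c (w # map g ys) \<noteq> 0. c (w # map g ys))"
    proof (rule sum.reindex_bij_betw[of g, THEN trans[rotated]])
      have "w \<in> V'" if "c (w # map g ys) \<noteq> 0" for w
        using chains_supportD(3)[OF c that] K' by auto
      then show "bij_betw g {v. relabel_chain g V c (v # ys) \<noteq> 0} {w. c (w # map g ys) \<noteq> 0}"
        using inj im True by (fastforce simp: bij_betw_def inj_on_def relabel_chain_def image_iff)
    next
      show "(\<Sum>v | relabel_chain g V c (v # ys) \<noteq> 0. relabel_chain g V c (v # ys)) =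
        (\<Sum>x\<in>{v. relabel_chain g V c (v # ys) \<noteq> 0}. c (g x # map g ys))"
        by (rule sum.cong) (auto simp: relabel_chain_def split: if_splits)
    qed
    then show ?thesis using True by (simp add: boundary_def relabel_chain_def[of g V "boundary c"])
  qed (auto simp: boundary_def relabel_chain_def)
qed

end

lemma relabel_chain_inverse:
  assumes bij: "bij_betw g V V'" and K: "\<And>\<sigma>. \<sigma> \<in> K \<Longrightarrow> \<sigma> \<subseteq> V"
    and c: "c \<in> simplicial_chains K k"
  shows "relabel_chain g V (relabel_chain (inv_into V g) V' c) = c"
proof
  fix xs
  have inj: "inj_on g V" and im: "g ` V = V'" using bij by (simp_all add: bij_betw_def)
  show "relabel_chain g V (relabel_chain (inv_into V g) V' c) xs = c xs"
  proof (cases "set xs \<subseteq> V")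
    case True
    then have "map (inv_into V g) (map g xs) = xs"
      using inj by (simp add: map_idI subset_iff)
    then show ?thesis using True im by (auto simp: relabel_chain_def)
  next
    case False
    then have "c xs = 0" using chains_supportD(3)[OF c] K by blast
    then show ?thesis using False by (simp add: relabel_chain_def)
  qed
qed

text \<open>
  Pulling back along \<open>g\<close> and along its inverse are mutually inverse and commute with the boundary,
  so a cycle can be carried over to \<open>K'\<close>, bounded there, and the bounding chain carried back.
\<close>

lemma trivial_homology_transfer:
  fixes K :: "'v set set" and K' :: "'w set set"
  assumes bij: "bij_betw g V V'"
    and faces: "\<And>\<sigma>. \<sigma> \<subseteq> V \<Longrightarrow> \<sigma> \<in> K \<longleftrightarrow> g ` \<sigma> \<in> K'"
    and K: "\<And>\<sigma>. \<sigma> \<in> K \<Longrightarrow> \<sigma> \<subseteq> V" and K': "\<And>\<sigma>. \<sigma> \<in> K' \<Longrightarrow> \<sigma> \<subseteq> V'"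
    and asc: "abstract_simplicial_complex K" "abstract_simplicial_complex K'"
    and triv: "trivial_group (simplicial_homology K' k :: ('w list \<Rightarrow> 'f::field) set monoid)"
  shows "trivial_group (simplicial_homology K k :: ('v list \<Rightarrow> 'f) set monoid)"
proof -
  define h where "h = inv_into V g"
  have bij': "bij_betw h V' V" unfolding h_def by (rule bij_betw_inv_into[OF bij])
  have inj: "inj_on g V" and im: "g ` V = V'" using bij by (simp_all add: bij_betw_def)
  have faces': "\<sigma> \<in> K' \<longleftrightarrow> h ` \<sigma> \<in> K" if "\<sigma> \<subseteq> V'" for \<sigma>
  proof -
    have "h ` \<sigma> \<subseteq> V" using bij' that by (auto simp: bij_betw_def)
    moreover have "g ` h ` \<sigma> = \<sigma>"
      unfolding h_def using im that image_inv_into_cancel by blast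
    ultimately show ?thesis using faces by simp
  qed
  have "c \<in> boundaries K k" if c: "c \<in> cycles K k" for c :: "'v list \<Rightarrow> 'f"
  proof -
    let ?c = "relabel_chain h V' c"
    have ch: "c \<in> simplicial_chains K k" and bd: "boundary c = (\<lambda>_. 0)"
      using c by (auto simp: cycles_def)
    have "boundary ?c = (\<lambda>_. 0)"
      using boundary_relabel_chain[OF bij' faces' K ch] bd
      by (simp add: relabel_chain_def fun_eq_iff)
    then have "?c \<in> cycles K' k"
      using relabel_chain_chains[OF bij' faces' K ch] by (simp add: cycles_def)
    then have "?c \<in> boundaries K' k"
      using triv trivial_simplicial_homology_iff[OF asc(2)] by blast
    then obtain b where b: "b \<in> simplicial_chains K' (Suc k)" "?c = boundary b"
      by (auto simp: boundaries_def)
    have "c = relabel_chain g V ?c"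
      unfolding h_def by (rule relabel_chain_inverse[OF bij K ch, symmetric])
    also have "\<dots> = boundary (relabel_chain g V b)"
      using boundary_relabel_chain[OF bij faces K' b(1)] b(2) by simp
    finally show ?thesis
      using relabel_chain_chains[OF bij faces K' b(1)] by (auto simp: boundaries_def)
  qed
  then show ?thesis
    unfolding trivial_simplicial_homology_iff[OF asc(1)]
    using boundaries_subset_cycles[OF asc(1)] by blast
qed

section \<open>Cycles need crowded points, and isolated hollow simplices give cycles\<close>

lemma cech_complexD:
  assumes "\<sigma> \<in> cech_complex X r" "p \<in> \<sigma>" "q \<in> \<sigma>"
  shows "dist p q \<le> r" "p \<in> X"
proof -
  obtain c where "c \<in> (\<Inter>p\<in>\<sigma>. cball p (r / 2))"
    using assms unfolding cech_complex_def by auto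
  then have "dist p c \<le> r / 2" "dist q c \<le> r / 2" using assms by auto
  then show "dist p q \<le> r" using dist_triangle2[of p q c] by linarith
  show "p \<in> X" using assms unfolding cech_complex_def by auto
qed

text \<open>
  A nonzero cycle contains a simplex \<open>[v, ys]\<close>. The coefficient of its boundary at \<open>ys\<close> can only
  cancel if a second simplex \<open>[w, ys]\<close> occurs, and as \<open>k \<ge> 1\<close> both simplices contain the first
  vertex of \<open>ys\<close>. The \<open>k + 2\<close> vertices involved all lie within \<open>r\<close> of that vertex.
\<close>

lemma nontrivial_homology_crowded:
  fixes X :: "'a::metric_space set"
  assumes k: "k \<ge> 1"
    and nontriv: "\<not> trivial_group (simplicial_homology (cech_complex X r) k :: ('a list \<Rightarrow> 'f::field) set monoid)"
  obtains xs where "distinct xs" "length xs = k + 2" "set xs \<subseteq> X" "\<And>p. p \<in> set xs \<Longrightarrow> dist p (hd xs) \<le> r"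
proof -
  let ?K = "cech_complex X r"
  have asc: "abstract_simplicial_complex ?K" by (rule abstract_simplicial_complex_cech)
  have "\<exists>c\<in>cycles ?K k. c \<noteq> (\<lambda>_. 0 :: 'f)"
  proof (rule ccontr)
    assume "\<not> ?thesis"
    then have "cycles ?K k \<subseteq> {\<lambda>_. 0 :: 'f}" by blast
    moreover have "(\<lambda>_. 0 :: 'f) \<in> boundaries ?K k"
      unfolding boundaries_def
      by (rule image_eqI[of _ _ "\<lambda>_. 0"]) (auto simp: zero_chains boundary_def)
    ultimately have "cycles ?K k = (boundaries ?K k :: ('a list \<Rightarrow> 'f) set)"
      using boundaries_subset_cycles[OF asc] by blast
    then show False using nontriv trivial_simplicial_homology_iff[OF asc] by blast
  qed
  then obtain c :: "'a list \<Rightarrow> 'f" and zs where c: "c \<in> simplicial_chains ?K k" "boundary c = (\<lambda>_. 0)" "c zs \<noteq> 0"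
    by (auto simp: cycles_def fun_eq_iff)
  obtain v ys where zs: "zs = v # ys" "length ys = k"
    using chains_supportD(2)[OF c(1,3)] by (cases zs) auto
  then obtain y ys' where ys: "ys = y # ys'" using k by (cases ys) auto
  \<comment> \<open>otherwise the boundary of \<open>c\<close> would have the coefficient \<open>c (v # ys) \<noteq> 0\<close> at \<open>ys\<close>\<close>
  have "\<exists>w. w \<noteq> v \<and> c (w # ys) \<noteq> 0"
  proof (rule ccontr)
    assume "\<not> ?thesis"
    then have "{w. c (w # ys) \<noteq> 0} = {v}" using c(3) zs by auto
    then have "boundary c ys = c (v # ys)" using ys by (simp add: boundary_def)
    then show False using c zs by simp
  qed
  then obtain w where w: "w \<noteq> v" "c (w # ys) \<noteq> 0" by blast
  have v: "distinct (v # ys)" "set (v # ys) \<in> ?K" and w': "distinct (w # ys)" "set (w # ys) \<in> ?K"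
    using chains_supportD[OF c(1,3)] chains_supportD[OF c(1) w(2)] zs by auto
  let ?xs = "y # v # w # ys'"
  show thesis
  proof
    show "distinct ?xs" using v w' w ys by auto
    show "length ?xs = k + 2" using ys zs by simp
    show "set ?xs \<subseteq> X"
      using cech_complexD(2)[OF v(2)] cech_complexD(2)[OF w'(2)] ys by auto
    show "dist p (hd ?xs) \<le> r" if "p \<in> set ?xs" for p
      using that cech_complexD(1)[OF v(2), of p y] cech_complexD(1)[OF w'(2), of p y] ys by auto
  qed
qed

text \<open>
  The oriented simplex \<open>[vs]\<close>: on a rearrangement of a distinct list \<open>vs\<close> it is the sign of the
  rearranging permutation. For distinct \<open>vs\<close> the sum has at most one term; writing it as a sum
  gives antisymmetry by reindexing.
\<close>

definition simplex_chain :: "'v list \<Rightarrow> 'v list \<Rightarrow> 'f::field" where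
  "simplex_chain vs xs = (\<Sum>p | p permutes {..<length vs} \<and> permute_list p vs = xs. of_int (sign p))"

lemma simplex_chain_chains:
  fixes vs :: "'v list"
  assumes vs: "distinct vs" "length vs = Suc k"
  shows "(simplex_chain vs :: 'v list \<Rightarrow> 'f::field) \<in> simplicial_chains {\<sigma>. \<sigma> \<noteq> {} \<and> \<sigma> \<subseteq> set vs} k"
proof -
  let ?n = "length vs"
  have nz: "\<exists>p. p permutes {..<?n} \<and> permute_list p vs = xs" if "simplex_chain vs xs \<noteq> (0::'f)" for xs
    using that unfolding simplex_chain_def by (metis (mono_tags, lifting) empty_Collect_eq sum.empty)
  have supp: "distinct xs \<and> length xs = Suc k \<and> set xs = set vs" if "simplex_chain vs xs \<noteq> (0::'f)" for xs
    using nz[OF that] vs by auto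
  have "finite {xs. simplex_chain vs xs \<noteq> (0::'f)}"
  proof (rule finite_subset)
    show "{xs. simplex_chain vs xs \<noteq> (0::'f)} \<subseteq> {xs. set xs \<subseteq> set vs \<and> length xs = Suc k}"
      using supp by auto
  qed (simp add: finite_lists_length_eq)
  moreover have "simplex_chain vs (permute_list q xs) = of_int (sign q) * (simplex_chain vs xs :: 'f)"
    if q: "q permutes {..<length xs}" for q xs
  proof (cases "length xs = ?n")
    case len: True
    have iff: "permute_list (p \<circ> q) vs = permute_list q xs \<longleftrightarrow> permute_list p vs = xs"
      if p: "p permutes {..<?n}" for p
    proof
      assume a: "permute_list (p \<circ> q) vs = permute_list q xs"
      have "permute_list q (permute_list p vs) = permute_list q xs"
        using a permute_list_compose[of q vs p] q len by simp
      then have "permute_list (inv_into UNIV q) (permute_list q (permute_list p vs)) = permute_list (inv_into UNIV q) (permute_list q xs)"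
        by simp
      moreover have "permute_list (inv_into UNIV q) (permute_list q ys) = ys" if "length ys = length xs" for ys :: "'v list"
        using permute_list_compose[of "inv_into UNIV q" ys q] permutes_inv[OF q] that permutes_inv_o(1)[OF q]
        by simp
      ultimately show "permute_list p vs = xs" using len by simp
    next
      assume "permute_list p vs = xs"
      then show "permute_list (p \<circ> q) vs = permute_list q xs"
        using permute_list_compose[of q vs p] q len by simp
    qed
    have qn: "q permutes {..<?n}" using q len by simp
    have "(simplex_chain vs (permute_list q xs) :: 'f) =
        (\<Sum>p | p permutes {..<?n} \<and> permute_list p vs = xs. of_int (sign (p \<circ> q)))"
      unfolding simplex_chain_def
    proof (rule sum.reindex_bij_witness[of _ "\<lambda>p. p \<circ> q" "\<lambda>p. p \<circ> inv_into UNIV q"])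
      fix p assume p: "p \<in> {p. p permutes {..<?n} \<and> permute_list p vs = permute_list q xs}"
      show 1: "p \<circ> inv_into UNIV q \<circ> q = p"
        by (simp add: comp_assoc permutes_inv_o(2)[OF q])
      have 2: "(p \<circ> inv_into UNIV q) permutes {..<?n}"
        using p permutes_compose[OF permutes_inv[OF qn]] by auto
      show "p \<circ> inv_into UNIV q \<in> {p. p permutes {..<?n} \<and> permute_list p vs = xs}"
        using iff[OF 2] 1 2 p by auto
      show "of_int (sign (p \<circ> inv_into UNIV q \<circ> q)) = (of_int (sign p) :: 'f)" using 1 by simp
    next
      fix p assume p: "p \<in> {p. p permutes {..<?n} \<and> permute_list p vs = xs}"
      show "p \<circ> q \<circ> inv_into UNIV q = p"
        by (simp add: comp_assoc permutes_inv_o(1)[OF q])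
      show "p \<circ> q \<in> {p. p permutes {..<?n} \<and> permute_list p vs = permute_list q xs}"
        using iff[of p] p permutes_compose[OF qn] by auto
    qed
    also have "\<dots> = (\<Sum>p | p permutes {..<?n} \<and> permute_list p vs = xs. of_int (sign q) * of_int (sign p))"
    proof (rule sum.cong[OF refl])
      fix p assume "p \<in> {p. p permutes {..<?n} \<and> permute_list p vs = xs}"
      then have "sign (p \<circ> q) = sign p * sign q"
        by (intro sign_compose) (use qn in \<open>auto intro: permutes_imp_permutation[of "{..<?n}"]\<close>)
      then show "of_int (sign (p \<circ> q)) = (of_int (sign q) * of_int (sign p) :: 'f)" by simp
    qed
    also have "\<dots> = of_int (sign q) * simplex_chain vs xs"
      by (simp add: simplex_chain_def sum_distrib_left)
    finally show ?thesis .
  next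
    case False
    then have "simplex_chain vs xs = (0::'f)" "simplex_chain vs (permute_list q xs) = (0::'f)"
      using supp[of xs] supp[of "permute_list q xs"] vs by auto
    then show ?thesis by simp
  qed
  moreover have "set vs \<noteq> {}" using vs by auto
  ultimately show ?thesis
    using supp vs unfolding simplicial_chains_def by fastforce
qed

lemma simplex_chain_self:
  assumes "distinct vs"
  shows "simplex_chain vs vs = 1"
proof -
  have "p = id" if p: "p permutes {..<length vs}" "permute_list p vs = vs" for p
  proof
    fix i
    show "p i = id i"
    proof (cases "i < length vs")
      case True
      then have "vs ! p i = vs ! i" using permute_list_nth[OF p(1) True] p(2) by simp
      moreover have "p i < length vs" using permutes_in_image[OF p(1), of i] True by simp
      ultimately show ?thesis using assms True by (simp add: nth_eq_iff_index_eq)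
    qed (use permutes_not_in[OF p(1)] in simp)
  qed
  then have "{p. p permutes {..<length vs} \<and> permute_list p vs = vs} = {id}"
    by (auto simp: permutes_id)
  then show ?thesis by (simp add: simplex_chain_def)
qed

text \<open>
  The boundary of the full simplex on \<open>vs\<close> is a cycle of \<open>K\<close>, because only facets occur in it. Its
  coefficient at the facet \<open>tl vs\<close> is \<open>1\<close>. No boundary of a \<open>(k + 1)\<close>-chain of \<open>K\<close> has this
  property: that facet is maximal in \<open>K\<close>, so such boundaries vanish on it.
\<close>

lemma hollow_simplex_homology:
  fixes K :: "'v set set"
  assumes asc: "abstract_simplicial_complex K"
    and vs: "distinct vs" "length vs = k + 2"
    and facets: "\<And>v. v \<in> set vs \<Longrightarrow> set vs - {v} \<in> K"
    and maximal: "\<And>w. w \<notin> set (tl vs) \<Longrightarrow> insert w (set (tl vs)) \<notin> K"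
  shows "\<not> trivial_group (simplicial_homology K k :: ('v list \<Rightarrow> 'f::field) set monoid)"
proof
  assume triv: "trivial_group (simplicial_homology K k :: ('v list \<Rightarrow> 'f) set monoid)"
  define \<Delta> where "\<Delta> = {\<sigma>. \<sigma> \<noteq> {} \<and> \<sigma> \<subseteq> set vs}"
  define e :: "'v list \<Rightarrow> 'f" where "e = simplex_chain vs"
  obtain v ys where v: "vs = v # ys" using vs by (cases vs) auto
  have e: "e \<in> simplicial_chains \<Delta> (Suc k)"
    unfolding e_def \<Delta>_def by (rule simplex_chain_chains) (use vs in auto)
  have "abstract_simplicial_complex \<Delta>"
    unfolding abstract_simplicial_complex_def \<Delta>_def using finite_subset[of _ "set vs"] by auto
  then have b: "boundary e \<in> simplicial_chains \<Delta> k"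
    by (rule boundary_chains[OF _ e])
  have in_K: "\<sigma> \<in> K" if "\<sigma> \<in> \<Delta>" "card \<sigma> = Suc k" for \<sigma>
  proof -
    have "\<sigma> \<subseteq> set vs" "\<sigma> \<noteq> {}" using that by (auto simp: \<Delta>_def)
    moreover have "\<sigma> \<noteq> set vs" using that vs distinct_card[of vs] by auto
    ultimately obtain u where "u \<in> set vs" "\<sigma> \<subseteq> set vs - {u}" "\<sigma> \<noteq> {}" by blast
    then show ?thesis using facets[of u] asc unfolding abstract_simplicial_complex_def by blast
  qed
  have "boundary e \<in> simplicial_chains K k"
    unfolding simplicial_chains_def
  proof (intro CollectI conjI allI impI)
    fix xs assume xs: "boundary e xs \<noteq> 0"
    note * = chains_supportD[OF b xs]
    show "distinct xs" "length xs = Suc k" using * by auto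
    then show "set xs \<in> K" using in_K[OF *(3)] distinct_card[of xs] by simp
  qed (use b in \<open>auto simp: simplicial_chains_def\<close>)
  then have "boundary e \<in> cycles K k"
    using boundary_boundary[OF e] by (simp add: cycles_def)
  then have "boundary e \<in> boundaries K k"
    using triv trivial_simplicial_homology_iff[OF asc] by blast
  then obtain b where b: "b \<in> simplicial_chains K (Suc k)" "boundary e = boundary b"
    by (auto simp: boundaries_def)
  have ys: "ys \<noteq> []" using v vs by auto
  have "b (w # ys) = 0" for w
  proof (rule ccontr)
    assume "b (w # ys) \<noteq> 0"
    note * = chains_supportD[OF b(1) this]
    then show False using maximal[of w] v by auto
  qed
  then have "boundary b ys = 0" by (simp add: boundary_def)
  moreover have "boundary e ys = 1"
  proof -
    have "w = v" if "e (w # ys) \<noteq> 0" for w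
    proof -
      note * = chains_supportD[OF e that]
      have "set (w # ys) = set vs"
        by (rule card_subset_eq)
          (use * vs distinct_card[of vs] distinct_card[OF *(1)] in \<open>auto simp: \<Delta>_def\<close>)
      then show ?thesis using *(1) v vs(1) by auto
    qed
    moreover have "e (v # ys) = 1"
      unfolding e_def v[symmetric] by (rule simplex_chain_self[OF vs(1)])
    ultimately have "{w. e (w # ys) \<noteq> 0} = {v}" by auto
    then show ?thesis using \<open>e (v # ys) = 1\<close> ys by (simp add: boundary_def)
  qed
  ultimately show False using b(2) by simp
qed

text \<open>
  Every vertex of a face containing the facet opposite to \<open>v 0\<close> lies within \<open>r\<close> of \<open>v 1\<close>. If there
  is no further point this close, then the only candidate for enlarging the facet is \<open>v 0\<close> itself,
  and the whole simplex is not a face.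
\<close>

lemma isolated_hollow_simplex_homology:
  fixes v :: "nat \<Rightarrow> 'a::metric_space"
  assumes X: "finite X" and v: "v ` {..k + 1} \<subseteq> X"
    and facets: "\<And>j. j \<le> k + 1 \<Longrightarrow> \<exists>c. \<forall>i\<le>k + 1. i \<noteq> j \<longrightarrow> dist (v i) c \<le> r / 2"
    and hollow: "\<not> (\<exists>c. \<forall>i\<le>k + 1. dist (v i) c \<le> r / 2)"
    and isolated: "\<And>p. p \<in> X \<Longrightarrow> dist p (v 1) \<le> r \<Longrightarrow> p \<in> v ` {..k + 1}"
  shows "\<not> trivial_group (simplicial_homology (cech_complex X r) k :: ('a list \<Rightarrow> 'f::field) set monoid)"
proof (rule hollow_simplex_homology)
  define vs where "vs = map v [0..<k + 2]"
  have range: "{0..<k + 2} = {..k + 1}" by auto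
  then have set: "set vs = v ` {..k + 1}" unfolding vs_def by (simp only: set_map set_upt)
  \<comment> \<open>if two points coincided, a center for a facet omitting one of them would serve all points\<close>
  have inj: "inj_on v {..k + 1}"
  proof (rule inj_onI, rule ccontr)
    fix i j assume ij: "i \<in> {..k + 1}" "j \<in> {..k + 1}" "v i = v j" "i \<noteq> j"
    obtain c where c: "\<forall>i\<le>k + 1. i \<noteq> j \<longrightarrow> dist (v i) c \<le> r / 2" using facets[of j] ij by auto
    have "dist (v l) c \<le> r / 2" if "l \<le> k + 1" for l
      using c[rule_format, of i] c[rule_format, of l] ij that by (cases "l = j") auto
    then show False using hollow by blast
  qed
  show "abstract_simplicial_complex (cech_complex X r)" by (rule abstract_simplicial_complex_cech)
  show dist_vs: "distinct (map v [0..<k + 2])"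
    using inj by (simp only: distinct_map set_upt range distinct_upt simp_thms)
  show "length (map v [0..<k + 2]) = k + 2" by simp
  show "set (map v [0..<k + 2]) - {u} \<in> cech_complex X r" if u: "u \<in> set (map v [0..<k + 2])" for u
  proof -
    obtain j where j: "j \<le> k + 1" "u = v j" using u unfolding set[unfolded vs_def] by blast
    obtain c where c: "\<forall>i\<le>k + 1. i \<noteq> j \<longrightarrow> dist (v i) c \<le> r / 2" using facets[OF j(1)] by auto
    have "c \<in> (\<Inter>p\<in>set vs - {u}. cball p (r / 2))"
      unfolding set using c j(2) by auto
    moreover have "set vs - {u} \<noteq> {}"
    proof
      assume "set vs - {u} = {}"
      then have "card (set vs) \<le> 1" by (metis Diff_eq_empty_iff card_mono card.empty card_insert_disjoint empty_iff finite.emptyI finite.insertI One_nat_def)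
      then show False using dist_vs distinct_card[of vs] by (simp add: vs_def)
    qed
    ultimately show ?thesis
      using X v set finite_subset[OF v X] unfolding cech_complex_def vs_def by blast
  qed
  show "insert w (set (tl (map v [0..<k + 2]))) \<notin> cech_complex X r"
    if w: "w \<notin> set (tl (map v [0..<k + 2]))" for w
  proof
    assume face: "insert w (set (tl (map v [0..<k + 2]))) \<in> cech_complex X r" (is "?\<sigma> \<in> _")
    have tl: "set (tl (map v [0..<k + 2])) = v ` {1..k + 1}"
      by (auto simp: upt_rec[of 0] image_iff simp del: upt_Suc)
    have "v 1 \<in> ?\<sigma>" unfolding tl by auto
    then have "dist w (v 1) \<le> r" "w \<in> X"
      using cech_complexD[OF face, of w "v 1"] by auto
    then have "w \<in> v ` {..k + 1}" using isolated by blast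
    then obtain i where i: "i \<le> k + 1" "w = v i" by auto
    then have "i = 0" using w unfolding tl by (cases i) auto
    moreover have "{..k + 1} = insert 0 {1..k + 1}" by auto
    ultimately have "?\<sigma> = v ` {..k + 1}" unfolding tl using i by (simp only: image_insert)
    then have "(\<Inter>p\<in>v ` {..k + 1}. cball p (r / 2)) \<noteq> {}"
      using face unfolding cech_complex_def by auto
    then obtain c where "c \<in> (\<Inter>p\<in>v ` {..k + 1}. cball p (r / 2))" by blast
    then have "\<forall>i\<le>k + 1. dist (v i) c \<le> r / 2" by simp
    then show False using hollow by blast
  qed
qed

section \<open>Hollow simplices that are stable under perturbation\<close>

text \<open>
  If the origin is a convex combination of unit vectors, then no ball of radius less than \<open>1\<close>
  contains all of them: in the weighted mean of the squared distances to \<open>c\<close> the terms linear in \<open>c\<close>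
  cancel, and what is left is \<open>1 + |c|\<^sup>2\<close>.
\<close>

lemma outside_radius:
  fixes w :: "nat \<Rightarrow> 'a::real_inner"
  assumes I: "finite I" and lam: "\<And>i. i \<in> I \<Longrightarrow> 0 < lam i"
    and ne: "I \<noteq> {}"
    and balanced: "(\<Sum>i\<in>I. lam i *\<^sub>R w i) = 0" and unit: "\<And>i. i \<in> I \<Longrightarrow> norm (w i) = 1"
  shows "\<exists>i\<in>I. 1 \<le> dist (w i) c"
proof (rule ccontr)
  assume "\<not> ?thesis"
  then have lt: "(dist (w i) c)\<^sup>2 < 1" if "i \<in> I" for i
    using that by (simp add: not_le power_less_one_iff abs_square_less_1)
  have eq: "(dist (w i) c)\<^sup>2 = 1 + (norm c)\<^sup>2 - 2 * (w i \<bullet> c)" if "i \<in> I" for i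
    using unit[OF that] dot_norm_neg[of "w i" c] by (simp add: dist_norm)
  have "(\<Sum>i\<in>I. lam i * (dist (w i) c)\<^sup>2) < (\<Sum>i\<in>I. lam i)"
    by (rule sum_strict_mono) (use I ne lam lt in auto)
  moreover have "(\<Sum>i\<in>I. lam i * (dist (w i) c)\<^sup>2) =
      (\<Sum>i\<in>I. lam i * (1 + (norm c)\<^sup>2) - 2 * ((lam i *\<^sub>R w i) \<bullet> c))"
    by (rule sum.cong) (simp_all add: eq algebra_simps)
  also have "\<dots> = (\<Sum>i\<in>I. lam i) * (1 + (norm c)\<^sup>2) - 2 * ((\<Sum>i\<in>I. lam i *\<^sub>R w i) \<bullet> c)"
    by (simp add: sum_subtractf sum_distrib_right sum_distrib_left inner_sum_left)
  also have "\<dots> \<ge> (\<Sum>i\<in>I. lam i)"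
    using sum_nonneg[of I lam] lam by (force simp: balanced algebra_simps less_imp_le)
  ultimately show False by simp
qed

text \<open>
  A small step from the origin into the common open half space of the vectors decreases all
  distances at once.
\<close>

lemma towards_closer:
  fixes w :: "'i \<Rightarrow> 'a::real_inner"
  assumes I: "finite I" and unit: "\<And>i. i \<in> I \<Longrightarrow> norm (w i) = 1"
    and pos: "\<And>i. i \<in> I \<Longrightarrow> 0 < w i \<bullet> c"
  shows "\<exists>t. \<exists>\<rho><1. \<forall>i\<in>I. dist (w i) (t *\<^sub>R c) \<le> \<rho>"
proof (cases "I = {}")
  case False
  define b where "b = Min ((\<lambda>i. w i \<bullet> c) ` I)"
  have b: "0 < b" "\<And>i. i \<in> I \<Longrightarrow> b \<le> w i \<bullet> c"
    using I False pos by (auto simp: b_def)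
  have c: "0 < norm c" using False pos by auto
  define t where "t = b / (norm c)\<^sup>2"
  have t: "0 < t" "t * (norm c)\<^sup>2 = b" using b c by (auto simp: t_def)
  have "dist (w i) (t *\<^sub>R c) \<le> sqrt (1 - t * b)" if "i \<in> I" for i
  proof (rule real_le_rsqrt)
    have "(dist (w i) (t *\<^sub>R c))\<^sup>2 = 1 + t * (t * (norm c)\<^sup>2) - 2 * t * (w i \<bullet> c)"
      using unit[OF that] dot_norm_neg[of "w i" "t *\<^sub>R c"] by (simp add: dist_norm power_mult_distrib power2_eq_square algebra_simps)
    also have "\<dots> \<le> 1 - t * b" 
      using mult_left_mono[OF b(2)[OF that], of t] t by (simp add: algebra_simps)
    finally show "(dist (w i) (t *\<^sub>R c))\<^sup>2 \<le> 1 - t * b" .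
  qed
  moreover have "sqrt (1 - t * b) < 1" using t b by simp
  ultimately show ?thesis by blast
qed (auto intro: exI[of _ 0])

text \<open>
  The vectors \<open>u\<^sub>1, \<dots>, u\<^sub>m\<close> are standard unit vectors and \<open>u\<^sub>0\<close> is the normalised negative of their
  sum \<open>s\<close>, so the origin lies in the relative interior of the simplex and the critical radius is \<open>1\<close>. Facets
  need a smaller radius, since each of them lies in an open half space: \<open>s\<close> points towards the facet
  opposite to \<open>u\<^sub>0\<close>, and \<open>s - (m + 1) e\<^sub>j\<close> towards the facet opposite to \<open>u\<^sub>j\<close>. Only \<open>m\<close> coordinate
  directions are used, which is where \<open>m \<le> CARD('d)\<close> enters.
\<close>

lemma hollow_simplex_exists:
  assumes m: "1 \<le> m" "m \<le> CARD('d)"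
  obtains u :: "nat \<Rightarrow> real ^ 'd" and \<rho> where "\<rho> < 1"
    "\<And>c. \<exists>i\<le>m. 1 \<le> dist (u i) c"
    "\<And>j. j \<le> m \<Longrightarrow> \<exists>c. \<forall>i\<le>m. i \<noteq> j \<longrightarrow> dist (u i) c \<le> \<rho>"
proof -
  obtain T :: "'d set" where "card T = m" "finite T"
    using obtain_subset_with_card_n[OF m(2)] by metis
  then obtain e0 where "bij_betw e0 {0..<m} T" using ex_bij_betw_nat_finite by metis
  then have e0: "inj_on e0 {0..<m}" by (simp add: bij_betw_def)
  define e where "e i = (axis (e0 (i - 1)) 1 :: real ^ 'd)" for i
  have inner_e: "e i \<bullet> e j = (if i = j then 1 else 0)" if "i \<in> {1..m}" "j \<in> {1..m}" for i j
  proof -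
    have "e0 (i - 1) = e0 (j - 1) \<longleftrightarrow> i = j"
    proof
      assume "e0 (i - 1) = e0 (j - 1)"
      then have "i - 1 = j - 1" using that inj_onD[OF e0, of "i - 1" "j - 1"] by auto
      then show "i = j" using that by auto
    qed simp
    then show ?thesis by (simp add: e_def inner_axis_axis)
  qed
  define s where "s = (\<Sum>i=1..m. e i)"
  have inner_s: "e i \<bullet> s = 1" if "i \<in> {1..m}" for i
    using that by (simp add: s_def inner_sum_right inner_e)
  have ss: "s \<bullet> s = m"
    by (subst s_def) (simp add: inner_sum_left inner_s)
  define u where "u i = (if i = 0 then - (1 / sqrt m) *\<^sub>R s else e i)" for i :: nat
  have unit: "norm (u i) = 1" if "i \<le> m" for i
  proof (cases "i = 0")
    case True
    then show ?thesis using m ss by (simp add: u_def norm_eq_sqrt_inner)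
  next
    case False
    then show ?thesis using that inner_e[of i i] by (simp add: u_def norm_eq_1)
  qed
  define lam where "lam i = (if i = 0 then sqrt m else 1)" for i :: nat
  have "(\<Sum>i\<le>m. lam i *\<^sub>R u i) = lam 0 *\<^sub>R u 0 + (\<Sum>i=1..m. lam i *\<^sub>R u i)"
    by (simp add: atMost_atLeast0 sum.atLeast_Suc_atMost)
  also have "(\<Sum>i=1..m. lam i *\<^sub>R u i) = s"
    unfolding s_def by (rule sum.cong) (auto simp: lam_def u_def)
  finally have balanced: "(\<Sum>i\<le>m. lam i *\<^sub>R u i) = 0" using m by (simp add: lam_def u_def)
  have "\<exists>i\<in>{..m}. 1 \<le> dist (u i) c" for c
    by (rule outside_radius[of _ lam]) (use balanced unit m in \<open>auto simp: lam_def\<close>)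
  then have outside: "\<exists>i\<le>m. 1 \<le> dist (u i) c" for c by auto
  have "\<exists>\<rho><1. \<exists>c. \<forall>i\<le>m. i \<noteq> j \<longrightarrow> dist (u i) c \<le> \<rho>" if j: "j \<le> m" for j
  proof -
    define c where "c = (if j = 0 then s else s - (m + 1) *\<^sub>R e j)"
    have "0 < u i \<bullet> c" if i: "i \<le> m" "i \<noteq> j" for i
    proof (cases "i = 0")
      case True
      then have "s \<bullet> e j = 1" "j \<noteq> 0" using inner_s[of j] i j by (auto simp: inner_commute)
      then have "s \<bullet> c = -1" by (simp add: c_def inner_diff_right ss)
      then show ?thesis using True m by (simp add: u_def)
    next
      case False
      then show ?thesis
        using i j inner_s[of i] inner_e[of i j] by (auto simp: u_def c_def inner_diff_right)
    qed
    then have "\<exists>t. \<exists>\<rho><1. \<forall>i\<in>{i. i \<le> m \<and> i \<noteq> j}. dist (u i) (t *\<^sub>R c) \<le> \<rho>"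
      by (intro towards_closer) (use unit in auto)
    then show ?thesis by blast
  qed
  then obtain R where R: "\<And>j. j \<le> m \<Longrightarrow> R j < 1"
     "\<And>j. j \<le> m \<Longrightarrow> \<exists>c. \<forall>i\<le>m. i \<noteq> j \<longrightarrow> dist (u i) c \<le> R j" by metis
  show thesis
  proof (rule that[of "Max (R ` {..m})" u])
    show "Max (R ` {..m}) < 1" using R(1) by simp
    show "\<exists>i\<le>m. 1 \<le> dist (u i) c" for c by (rule outside)
    fix j assume j: "j \<le> m"
    then have "R j \<le> Max (R ` {..m})" by simp
    then show "\<exists>c. \<forall>i\<le>m. i \<noteq> j \<longrightarrow> dist (u i) c \<le> Max (R ` {..m})"
      using R(2)[OF j] by (meson order_trans)
  qed
qed

text \<open>
  The gap between the radius needed for the facets and the radius needed for the whole simplex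
  leaves room to move every vertex by a fixed fraction of the scale.
\<close>

lemma stable_hollow_simplex:
  assumes m: "1 \<le> m" "m \<le> CARD('d)"
  obtains u :: "nat \<Rightarrow> real ^ 'd" and \<eta> where "0 < \<eta>"
    "\<And>s z v. 0 < s \<Longrightarrow> (\<And>i. i \<le> m \<Longrightarrow> dist (v i) (z + s *\<^sub>R u i) \<le> s * \<eta>) \<Longrightarrow>
      \<not> (\<exists>c. \<forall>i\<le>m. dist (v i) c \<le> s / 2) \<and>
      (\<forall>j\<le>m. \<exists>c. \<forall>i\<le>m. i \<noteq> j \<longrightarrow> dist (v i) c \<le> s / 2)"
proof -
  obtain w :: "nat \<Rightarrow> real ^ 'd" and \<rho> where w: "\<rho> < 1"
    "\<And>c. \<exists>i\<le>m. 1 \<le> dist (w i) c"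
    "\<And>j. j \<le> m \<Longrightarrow> \<exists>c. \<forall>i\<le>m. i \<noteq> j \<longrightarrow> dist (w i) c \<le> \<rho>"
    using hollow_simplex_exists[OF m] by metis
  \<comment> \<open>after scaling by \<open>L\<close> the radius \<open>1 / 2\<close> lies midway between those needed for facets and for the whole\<close>
  define \<rho>' where "\<rho>' = max \<rho> 0"
  define L where "L = 1 / (1 + \<rho>')"
  define \<eta> where "\<eta> = L * (1 - \<rho>') / 4"
  have \<rho>': "0 \<le> \<rho>'" "\<rho>' < 1" "\<rho> \<le> \<rho>'" using w(1) by (auto simp: \<rho>'_def)
  have L: "0 < L" and \<eta>: "0 < \<eta>" using \<rho>' by (auto simp: L_def \<eta>_def)
  define y where "y = L * \<rho>'"
  have "L + y = 1" using \<rho>' by (simp add: L_def y_def field_simps)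
  moreover have "y < L" using mult_strict_left_mono[OF \<rho>'(2) L] by (simp add: y_def)
  moreover have "\<eta> = (L - y) / 4" by (simp add: \<eta>_def y_def algebra_simps)
  ultimately have "y + \<eta> \<le> 1 / 2" "1 / 2 + \<eta> < L" by auto
  then have half: "L * \<rho>' + \<eta> \<le> 1 / 2" "1 / 2 + \<eta> < L" by (simp_all add: y_def)
  define u where "u i = L *\<^sub>R w i" for i
  show thesis
  proof (rule that[OF \<eta>, of u], intro conjI allI impI notI)
    fix s :: real and z and v :: "nat \<Rightarrow> real ^ 'd"
    assume s: "0 < s" and v: "\<And>i. i \<le> m \<Longrightarrow> dist (v i) (z + s *\<^sub>R u i) \<le> s * \<eta>"
    have scale: "dist (z + s *\<^sub>R u i) (z + (s * L) *\<^sub>R c) = s * (L * dist (w i) c)" for i c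
    proof -
      have "(z + s *\<^sub>R u i) - (z + (s * L) *\<^sub>R c) = (s * L) *\<^sub>R (w i - c)"
        by (simp add: u_def algebra_simps)
      then show ?thesis using s L by (simp add: dist_norm)
    qed
    {
      assume "\<exists>c. \<forall>i\<le>m. dist (v i) c \<le> s / 2"
      then obtain c where c: "\<And>i. i \<le> m \<Longrightarrow> dist (v i) c \<le> s / 2" by auto
      define c' where "c' = (1 / (s * L)) *\<^sub>R (c - z)"
      have cc': "c = z + (s * L) *\<^sub>R c'" using s L by (simp add: c'_def)
      obtain i where i: "i \<le> m" "1 \<le> dist (w i) c'" using w(2) by blast
      have "s * L \<le> s * (L * dist (w i) c')" using i(2) s L by simp
      also have "\<dots> = dist (z + s *\<^sub>R u i) c" unfolding cc' by (rule scale[symmetric])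
      also have "\<dots> \<le> s * \<eta> + s / 2"
        using dist_triangle3[of "z + s *\<^sub>R u i" c "v i"] v[OF i(1)] c[OF i(1)] by linarith
      also have "\<dots> = s * (1 / 2 + \<eta>)" by (simp add: algebra_simps)
      also have "\<dots> < s * L" using half s by simp
      finally show False by simp
    }
    fix j assume "j \<le> m"
    then obtain c where c: "\<And>i. i \<le> m \<Longrightarrow> i \<noteq> j \<Longrightarrow> dist (w i) c \<le> \<rho>'"
      using w(3) \<rho>'(3) by (meson order_trans)
    have "dist (v i) (z + (s * L) *\<^sub>R c) \<le> s / 2" if i: "i \<le> m" "i \<noteq> j" for i
    proof -
      have "dist (v i) (z + (s * L) *\<^sub>R c) \<le> s * \<eta> + s * (L * dist (w i) c)"
        using dist_triangle[of "v i" "z + (s * L) *\<^sub>R c" "z + s *\<^sub>R u i"] v[OF i(1)]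
        unfolding scale by linarith
      also have "\<dots> \<le> s * \<eta> + s * (L * \<rho>')"
        using c[OF i] s L by simp
      also have "\<dots> = s * (L * \<rho>' + \<eta>)" by (simp add: algebra_simps)
      also have "\<dots> \<le> s * (1 / 2)" using half s by (intro mult_left_mono) auto
      finally show ?thesis by simp
    qed
    then show "\<exists>c. \<forall>i\<le>m. i \<noteq> j \<longrightarrow> dist (v i) c \<le> s / 2" by blast
  qed
qed

section \<open>Measurability of the homology events\<close>

text \<open>
  Up to a relabelling of its vertices the Cech complex of indexed points is determined by a finite
  amount of data: which points coincide and which families of balls meet.
\<close>

lemma trivial_homology_pattern:
  fixes a b :: "nat \<Rightarrow> 'a::metric_space"
  assumes eq: "\<And>i j. i < n \<Longrightarrow> j < n \<Longrightarrow> a i = a j \<longleftrightarrow> b i = b j"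
    and faces: "\<And>J. J \<subseteq> {..<n} \<Longrightarrow> J \<noteq> {} \<Longrightarrow>
      (\<Inter>i\<in>J. cball (a i) (r / 2)) \<noteq> {} \<longleftrightarrow> (\<Inter>i\<in>J. cball (b i) (r / 2)) \<noteq> {}"
    and triv: "trivial_group (simplicial_homology (cech_complex (a ` {..<n}) r) k :: ('a list \<Rightarrow> 'f::field) set monoid)"
  shows "trivial_group (simplicial_homology (cech_complex (b ` {..<n}) r) k :: ('a list \<Rightarrow> 'f) set monoid)"
proof -
  define g where "g = a \<circ> inv_into {..<n} b"
  have g: "g (b i) = a i" if "i < n" for i
  proof -
    have "b i \<in> b ` {..<n}" using that by simp
    from inv_into_into[OF this] f_inv_into_f[OF this]
    have "inv_into {..<n} b (b i) < n" "b (inv_into {..<n} b (b i)) = b i" by simp_all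
    then show ?thesis using eq[of "inv_into {..<n} b (b i)" i] that by (simp add: g_def)
  qed
  have img: "g ` b ` J = a ` J" if "J \<subseteq> {..<n}" for J
    unfolding image_image using g that by (intro image_cong) auto
  have bij: "bij_betw g (b ` {..<n}) (a ` {..<n})"
    unfolding bij_betw_def
  proof
    show "inj_on g (b ` {..<n})"
      by (rule inj_onI) (auto simp: g eq)
  qed (rule img[OF order_refl])
  have iff: "\<sigma> \<in> cech_complex (b ` {..<n}) r \<longleftrightarrow> g ` \<sigma> \<in> cech_complex (a ` {..<n}) r"
    if \<sigma>: "\<sigma> \<subseteq> b ` {..<n}" for \<sigma>
  proof -
    obtain J where J: "J \<subseteq> {..<n}" "\<sigma> = b ` J" using subset_imageE[OF \<sigma>] by blast
    have "finite J" using J(1) finite_subset by blast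
    then show ?thesis
      unfolding J(2) img[OF J(1)] cech_complex_def using J(1) faces[of J]
      by (cases "J = {}") (simp_all add: image_mono)
  qed
  have sub: "\<sigma> \<subseteq> X" if "\<sigma> \<in> cech_complex X r" for X and \<sigma> :: "'a set"
    using that by (simp add: cech_complex_def)
  show ?thesis
    by (rule trivial_homology_transfer[OF bij iff sub sub abstract_simplicial_complex_cech
          abstract_simplicial_complex_cech triv])
qed

text \<open>
  The existence of a common point of closed balls involves an uncountable choice. By compactness it
  is equivalent to the existence of points from a countable dense set that are nearly common, and
  that condition is measurable.
\<close>

lemma balls_meet_iff_approximately:
  fixes a :: "'i \<Rightarrow> 'a::{heine_borel}"
  assumes J: "J \<noteq> {}" "finite J" and D: "\<And>U::'a set. open U \<Longrightarrow> U \<noteq> {} \<Longrightarrow> \<exists>d\<in>D. d \<in> U"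
  shows "(\<Inter>i\<in>J. cball (a i) s) \<noteq> {} \<longleftrightarrow> (\<forall>m. \<exists>c\<in>D. \<forall>i\<in>J. dist (a i) c < s + 1 / real (Suc m))"
proof
  assume "(\<Inter>i\<in>J. cball (a i) s) \<noteq> {}"
  then obtain c where "c \<in> (\<Inter>i\<in>J. cball (a i) s)" by blast
  then have c: "\<And>i. i \<in> J \<Longrightarrow> dist (a i) c \<le> s" by simp
  show "\<forall>m. \<exists>c\<in>D. \<forall>i\<in>J. dist (a i) c < s + 1 / real (Suc m)"
  proof
    fix m
    obtain d where d: "d \<in> D" "d \<in> ball c (1 / real (Suc m))"
      using D[of "ball c (1 / real (Suc m))"] by auto
    have "dist (a i) d < s + 1 / real (Suc m)" if "i \<in> J" for i
      using c[OF that] d(2) dist_triangle[of "a i" d c] by simp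
    then show "\<exists>c\<in>D. \<forall>i\<in>J. dist (a i) c < s + 1 / real (Suc m)" using d(1) by blast
  qed
next
  assume "\<forall>m. \<exists>c\<in>D. \<forall>i\<in>J. dist (a i) c < s + 1 / real (Suc m)"
  then obtain c where c: "\<And>m i. i \<in> J \<Longrightarrow> dist (a i) (c m) < s + 1 / real (Suc m)" by metis
  obtain i0 where i0: "i0 \<in> J" using J by blast
  have "c m \<in> cball (a i0) (s + 1)" for m
  proof -
    have "1 / real (Suc m) \<le> 1" by simp
    then show ?thesis using c[OF i0, of m] unfolding mem_cball by linarith
  qed
  then obtain l f where l: "strict_mono (f :: nat \<Rightarrow> nat)" "(c \<circ> f) \<longlonglongrightarrow> l"
    using compact_cball[of "a i0" "s + 1"] unfolding compact_def by meson
  have "dist (a i) l \<le> s" if "i \<in> J" for i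
  proof (rule tendsto_le[OF trivial_limit_sequentially])
    show "(\<lambda>m. dist (a i) ((c \<circ> f) m)) \<longlonglongrightarrow> dist (a i) l"
      by (intro tendsto_intros l)
    have "(\<lambda>m. 1 / real (Suc m)) \<longlonglongrightarrow> 0" by (rule LIMSEQ_Suc[OF lim_1_over_n])
    then have "(\<lambda>m. s + 1 / real (Suc (f m))) \<longlonglongrightarrow> s + 0"
      by (intro tendsto_intros) (use LIMSEQ_subseq_LIMSEQ[OF _ l(1)] in \<open>auto simp: o_def\<close>)
    then show "(\<lambda>m. s + 1 / real (Suc (f m))) \<longlonglongrightarrow> s" by simp
    show "\<forall>\<^sub>F m in sequentially. dist (a i) ((c \<circ> f) m) \<le> s + 1 / real (Suc (f m))"
      using c[OF that] by (intro always_eventually allI) (simp add: less_imp_le)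
  qed
  then have "l \<in> (\<Inter>i\<in>J. cball (a i) s)" by simp
  then show "(\<Inter>i\<in>J. cball (a i) s) \<noteq> {}" by blast
qed

text \<open>
  The event is a union of classes of sample points with the same pattern. There are only finitely
  many patterns, and each class is measurable.
\<close>

lemma sets_trivial_homology:
  fixes x :: "nat \<Rightarrow> 'w \<Rightarrow> 'a::euclidean_space"
  assumes x: "\<And>i. x i \<in> borel_measurable M"
  shows "{\<omega> \<in> space M. trivial_group (simplicial_homology (cech_complex ((\<lambda>i. x i \<omega>) ` {..<n}) r) k
             :: ('a list \<Rightarrow> 'f::field) set monoid)} \<in> sets M" (is "{\<omega> \<in> space M. ?T \<omega>} \<in> _")
proof -
  define faces where "faces \<omega> = {J. J \<subseteq> {..<n} \<and> J \<noteq> {} \<and> (\<Inter>i\<in>J. cball (x i \<omega>) (r / 2)) \<noteq> {}}" for \<omega>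
  define eqs where "eqs \<omega> = {(i, j). i < n \<and> j < n \<and> x i \<omega> = x j \<omega>}" for \<omega>
  define pat where "pat \<omega> = (eqs \<omega>, faces \<omega>)" for \<omega>
  have T: "?T \<omega>'" if "pat \<omega> = pat \<omega>'" "?T \<omega>" for \<omega> \<omega>'
  proof (rule trivial_homology_pattern[OF _ _ that(2)])
    show "x i \<omega> = x j \<omega> \<longleftrightarrow> x i \<omega>' = x j \<omega>'" if "i < n" "j < n" for i j
      using \<open>pat \<omega> = pat \<omega>'\<close> that by (auto simp: pat_def eqs_def set_eq_iff)
    show "(\<Inter>i\<in>J. cball (x i \<omega>) (r / 2)) \<noteq> {} \<longleftrightarrow> (\<Inter>i\<in>J. cball (x i \<omega>') (r / 2)) \<noteq> {}"
      if "J \<subseteq> {..<n}" "J \<noteq> {}" for J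
    proof -
      have "J \<in> faces \<omega> \<longleftrightarrow> J \<in> faces \<omega>'" using \<open>pat \<omega> = pat \<omega>'\<close> by (simp add: pat_def)
      then show ?thesis using that by (simp add: faces_def)
    qed
  qed
  obtain D :: "'a set" where D: "countable D" "\<And>U. open U \<Longrightarrow> U \<noteq> {} \<Longrightarrow> \<exists>d\<in>D. d \<in> U"
    using countable_dense_exists by blast
  have faces_meas: "{\<omega> \<in> space M. J \<in> faces \<omega>} \<in> sets M" if J: "J \<subseteq> {..<n}" for J
  proof (cases "J = {}")
    case False
    have "finite J" using J finite_subset by blast
    then have "{\<omega> \<in> space M. J \<in> faces \<omega>} =
        {\<omega> \<in> space M. \<forall>m. \<exists>c\<in>D. \<forall>i\<in>J. dist (x i \<omega>) c < r / 2 + 1 / real (Suc m)}"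
      unfolding faces_def using J False balls_meet_iff_approximately[OF False _ D(2)] by simp
    also have "\<dots> \<in> sets M"
      by (intro sets.sets_Collect_countable_All sets.sets_Collect_countable_Ex' D(1)
        sets.sets_Collect_finite_All' \<open>finite J\<close> False borel_measurable_less
        borel_measurable_dist x borel_measurable_const)
    finally show ?thesis .
  qed (simp add: faces_def)
  have eqs_meas: "{\<omega> \<in> space M. ij \<in> eqs \<omega>} \<in> sets M" if "ij \<in> {..<n} \<times> {..<n}" for ij
  proof -
    have "{\<omega> \<in> space M. ij \<in> eqs \<omega>} = {\<omega> \<in> space M. dist (x (fst ij) \<omega>) (x (snd ij) \<omega>) = 0}"
      using that by (auto simp: eqs_def)
    also have "\<dots> \<in> sets M"
      by (intro borel_measurable_eq borel_measurable_dist x borel_measurable_const)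
    finally show ?thesis .
  qed
  have pat_meas: "{\<omega> \<in> space M. pat \<omega> = P} \<in> sets M" if P: "P \<in> Pow ({..<n} \<times> {..<n}) \<times> Pow (Pow {..<n})" for P
  proof -
    have e: "eqs \<omega> = fst P \<longleftrightarrow> (\<forall>ij\<in>{..<n} \<times> {..<n}. (ij \<in> eqs \<omega>) = (ij \<in> fst P))" for \<omega>
    proof -
      have "eqs \<omega> \<subseteq> {..<n} \<times> {..<n}" "fst P \<subseteq> {..<n} \<times> {..<n}" using P by (auto simp: eqs_def)
      then show ?thesis by blast
    qed
    have f: "faces \<omega> = snd P \<longleftrightarrow> (\<forall>J\<in>Pow {..<n}. (J \<in> faces \<omega>) = (J \<in> snd P))" for \<omega>
    proof -
      have "faces \<omega> \<subseteq> Pow {..<n}" "snd P \<subseteq> Pow {..<n}" using P by (auto simp: faces_def)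
      then show ?thesis by blast
    qed
    have iff: "{\<omega> \<in> space M. Q \<omega> = b} \<in> sets M" if "{\<omega> \<in> space M. Q \<omega>} \<in> sets M" for Q b
      using that sets.sets_Collect_neg[OF that] by (cases b) simp_all
    have "{\<omega> \<in> space M. pat \<omega> = P} = {\<omega> \<in> space M.
        (\<forall>ij\<in>{..<n} \<times> {..<n}. (ij \<in> eqs \<omega>) = (ij \<in> fst P)) \<and> (\<forall>J\<in>Pow {..<n}. (J \<in> faces \<omega>) = (J \<in> snd P))}"
      by (simp add: pat_def prod_eq_iff e f)
    also have "\<dots> \<in> sets M"
      by (intro sets.sets_Collect_conj sets.sets_Collect_finite_All iff faces_meas eqs_meas) auto
    finally show ?thesis .
  qed
  have fin: "finite (Pow ({..<n} \<times> {..<n}) \<times> Pow (Pow {..<n}))" by simp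
  have range: "pat \<omega> \<in> Pow ({..<n} \<times> {..<n}) \<times> Pow (Pow {..<n})" for \<omega>
    by (auto simp: pat_def eqs_def faces_def)
  have "{\<omega> \<in> space M. ?T \<omega>} = (\<Union>P\<in>pat ` {\<omega> \<in> space M. ?T \<omega>}. {\<omega> \<in> space M. pat \<omega> = P})"
  proof (intro equalityI subsetI)
    fix \<omega> assume "\<omega> \<in> (\<Union>P\<in>pat ` {\<omega> \<in> space M. ?T \<omega>}. {\<omega> \<in> space M. pat \<omega> = P})"
    then obtain \<omega>' where "pat \<omega>' = pat \<omega>" "?T \<omega>'" "\<omega> \<in> space M" by force
    then show "\<omega> \<in> {\<omega> \<in> space M. ?T \<omega>}" using T[of \<omega>' \<omega>] by blast
  qed blast
  also have "\<dots> \<in> sets M"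
  proof (rule sets.finite_UN)
    show "finite (pat ` {\<omega> \<in> space M. ?T \<omega>})"
      by (rule finite_subset[OF _ fin]) (use range in blast)
    show "{\<omega> \<in> space M. pat \<omega> = P} \<in> sets M" if "P \<in> pat ` {\<omega> \<in> space M. ?T \<omega>}" for P
      using that range by (intro pat_meas) blast
  qed
  finally show ?thesis .
qed

section \<open>Independent points: crowding and isolated patterns\<close>

locale iid_points = prob_space M for M :: "'w measure" +
  fixes x :: "nat \<Rightarrow> 'w \<Rightarrow> 'a::euclidean_space" and D :: "'a measure"
  assumes indep: "indep_vars (\<lambda>_. borel) x UNIV" and law: "\<And>i. distr M borel (x i) = D"
begin

lemma rv [measurable]: "x i \<in> borel_measurable M"
  using indep by (auto simp: indep_vars_def)

lemma sets_D [measurable_cong, simp]: "sets D = sets borel"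
  using law[of 0] by auto

lemma prob_space_D: "prob_space D"
  unfolding law[of 0, symmetric] by (rule prob_space_distr) measurable

lemma prob_joint:
  assumes "finite S" "\<And>i. i \<in> S \<Longrightarrow> A i \<in> sets borel"
  shows "prob {\<omega> \<in> space M. \<forall>i\<in>S. x i \<omega> \<in> A i} = (\<Prod>i\<in>S. measure D (A i))"
proof (cases "S = {}")
  case False
  have "prob (\<Inter>i\<in>S. x i -` A i \<inter> space M) = (\<Prod>i\<in>S. prob (x i -` A i \<inter> space M))"
    by (rule indep_varsD[OF indep]) (use assms False in auto)
  also have "\<dots> = (\<Prod>i\<in>S. measure D (A i))"
  proof (rule prod.cong[OF refl])
    fix i assume "i \<in> S"
    then show "prob (x i -` A i \<inter> space M) = measure D (A i)"
      using measure_distr[OF rv, of "A i" i] assms(2) law[of i] by simp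
  qed
  also have "(\<Inter>i\<in>S. x i -` A i \<inter> space M) = {\<omega> \<in> space M. \<forall>i\<in>S. x i \<omega> \<in> A i}"
    using False by auto
  finally show ?thesis .
qed (simp add: prob_space)

text \<open>
  The cells \<open>Q z\<close> replace conditioning on the position of the point \<open>i0\<close>: inside one cell the events
  for the different points are independent, and the probabilities of the cells for \<open>i0\<close> add up to
  at most \<open>1\<close>.
\<close>

lemma crowding_bound:
  fixes Q R :: "'z::countable \<Rightarrow> 'a set"
  assumes [measurable]: "\<And>z. Q z \<in> sets borel" "\<And>z. R z \<in> sets borel"
    and disj: "disjoint_family Q"
    and tau: "\<And>z. measure D (R z) \<le> \<tau>" and S: "finite S" "i0 \<notin> S"
  shows "prob {\<omega> \<in> space M. \<exists>z. x i0 \<omega> \<in> Q z \<and> (\<forall>i\<in>S. x i \<omega> \<in> R z)} \<le> \<tau> ^ card S"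
proof -
  define E where "E z = {\<omega> \<in> space M. x i0 \<omega> \<in> Q z \<and> (\<forall>i\<in>S. x i \<omega> \<in> R z)}" for z
  define F where "F z = {\<omega> \<in> space M. x i0 \<omega> \<in> Q z}" for z
  have [measurable]: "E z \<in> events" "F z \<in> events" for z unfolding E_def F_def using S(1) by measurable
  have disjF: "disjoint_family F" and disjE: "disjoint_family E"
    using disj by (fastforce simp: disjoint_family_on_def E_def F_def)+
  have tau0: "0 \<le> \<tau>" using tau[of undefined] measure_nonneg[of D "R undefined"] by linarith
  have E: "emeasure M (E z) \<le> emeasure M (F z) * ennreal (\<tau> ^ card S)" for z
  proof -
    have "prob (E z) = prob {\<omega> \<in> space M. \<forall>i\<in>insert i0 S. x i \<omega> \<in> (if i = i0 then Q z else R z)}"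
      unfolding E_def using S(2) by (intro arg_cong[where f=prob]) auto
    also have "\<dots> = (\<Prod>i\<in>insert i0 S. measure D (if i = i0 then Q z else R z))"
      by (rule prob_joint) (use S(1) assms(1,2) in simp_all)
    also have "\<dots> = measure D (Q z) * (\<Prod>i\<in>S. measure D (if i = i0 then Q z else R z))"
      using S by simp
    also have "(\<Prod>i\<in>S. measure D (if i = i0 then Q z else R z)) = (\<Prod>i\<in>S. measure D (R z))"
      using S by (intro prod.cong) auto
    also have "measure D (Q z) = prob (F z)"
      using prob_joint[of "{i0}" "\<lambda>_. Q z"] by (simp add: F_def)
    also have "(\<Prod>i\<in>S. measure D (R z)) \<le> \<tau> ^ card S"
      using tau[of z] by (simp add: power_mono)
    finally have "prob (E z) \<le> prob (F z) * \<tau> ^ card S" by (simp add: mult_left_mono)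
    then show ?thesis
      using tau0 by (simp add: emeasure_eq_measure ennreal_mult[symmetric] ennreal_leI)
  qed
  have "{\<omega> \<in> space M. \<exists>z. x i0 \<omega> \<in> Q z \<and> (\<forall>i\<in>S. x i \<omega> \<in> R z)} = (\<Union>z. E z)"
    by (auto simp: E_def)
  then have "emeasure M {\<omega> \<in> space M. \<exists>z. x i0 \<omega> \<in> Q z \<and> (\<forall>i\<in>S. x i \<omega> \<in> R z)} = emeasure M (\<Union>z. E z)"
    by simp
  also have "\<dots> = (\<integral>\<^sup>+z. emeasure M (E z) \<partial>count_space UNIV)"
    by (rule emeasure_UN_countable) (use disjE in auto)
  also have "\<dots> \<le> (\<integral>\<^sup>+z. emeasure M (F z) * ennreal (\<tau> ^ card S) \<partial>count_space UNIV)"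
    by (intro nn_integral_mono E)
  also have "\<dots> = (\<integral>\<^sup>+z. emeasure M (F z) \<partial>count_space UNIV) * ennreal (\<tau> ^ card S)"
    by (rule nn_integral_multc) simp
  also have "(\<integral>\<^sup>+z. emeasure M (F z) \<partial>count_space UNIV) = emeasure M (\<Union>z. F z)"
    by (rule emeasure_UN_countable[symmetric]) (use disjF in auto)
  also have "emeasure M (\<Union>z. F z) * ennreal (\<tau> ^ card S) \<le> 1 * ennreal (\<tau> ^ card S)"
    by (intro mult_right_mono emeasure_le_1) auto
  finally show ?thesis using tau0 by (simp add: emeasure_eq_measure)
qed

definition hits :: "nat set \<Rightarrow> 'a set \<Rightarrow> 'w \<Rightarrow> real" where
  "hits K B \<omega> = (\<Sum>i\<in>K. indicator B (x i \<omega>))"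

lemma hits_measurable [measurable]:
  assumes [measurable]: "B \<in> sets borel"
  shows "hits K B \<in> borel_measurable M"
  unfolding hits_def[abs_def] by measurable

lemma integrable_hits_mult:
  assumes "finite K" "B \<in> sets borel" "B' \<in> sets borel"
  shows "integrable M (\<lambda>\<omega>. hits K B \<omega> * hits K B' \<omega>)" "integrable M (hits K B)"
proof -
  have 1: "\<bar>hits K B \<omega>\<bar> \<le> card K" for B \<omega>
  proof -
    have "hits K B \<omega> \<le> (\<Sum>i\<in>K. 1)" unfolding hits_def by (intro sum_mono) (simp add: indicator_def)
    moreover have "0 \<le> hits K B \<omega>" unfolding hits_def by (intro sum_nonneg) simp
    ultimately show ?thesis by simp
  qed
  show "integrable M (hits K B)"
    by (rule integrable_const_bound[where B="card K"]) (use 1 assms in auto)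
  have "\<bar>hits K B \<omega> * hits K B' \<omega>\<bar> \<le> real (card K) * real (card K)" for \<omega>
    unfolding abs_mult by (intro mult_mono 1) auto
  then show "integrable M (\<lambda>\<omega>. hits K B \<omega> * hits K B' \<omega>)"
    by (intro integrable_const_bound[where B="real (card K) * real (card K)"]) (use assms in auto)
qed

lemma expectation_indicators:
  assumes "finite S" "\<And>i. i \<in> S \<Longrightarrow> A i \<in> sets borel"
  shows "expectation (\<lambda>\<omega>. \<Prod>i\<in>S. indicator (A i) (x i \<omega>)) = (\<Prod>i\<in>S. measure D (A i))"
    and "integrable M (\<lambda>\<omega>. \<Prod>i\<in>S. indicator (A i) (x i \<omega>) :: real)"
proof -
  have eq: "(\<Prod>i\<in>S. indicator (A i) (x i \<omega>)) = (indicator {\<omega> \<in> space M. \<forall>i\<in>S. x i \<omega> \<in> A i} \<omega> :: real)"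
    if "\<omega> \<in> space M" for \<omega>
    using that assms(1) by (auto simp: indicator_def prod_zero_iff)
  have ev: "{\<omega> \<in> space M. \<forall>i\<in>S. x i \<omega> \<in> A i} \<in> events"
    by (intro sets.sets_Collect_finite_All assms(1)) (use assms(2) in measurable)
  show "expectation (\<lambda>\<omega>. \<Prod>i\<in>S. indicator (A i) (x i \<omega>)) = (\<Prod>i\<in>S. measure D (A i))"
    using prob_joint[of S A] assms ev by (simp add: eq cong: Bochner_Integration.integral_cong)
  show "integrable M (\<lambda>\<omega>. \<Prod>i\<in>S. indicator (A i) (x i \<omega>) :: real)"
    using ev by (simp add: eq emeasure_eq_measure cong: Bochner_Integration.integrable_cong)
qed

lemma expectation_hits:
  assumes "finite K" "B \<in> sets borel"
  shows "expectation (hits K B) = card K * measure D B"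
  using expectation_indicators[of "{i}" "\<lambda>_. B" for i] assms
  by (simp add: hits_def[abs_def] Bochner_Integration.integral_sum)

text \<open>
  Distinct indices contribute products of probabilities; the diagonal contributes only through
  \<open>B \<inter> B'\<close>. In particular the counts of disjoint sets are negatively correlated.
\<close>

lemma expectation_hits_mult_le:
  assumes K: "finite K" and B: "B \<in> sets borel" "B' \<in> sets borel"
  shows "expectation (\<lambda>\<omega>. hits K B \<omega> * hits K B' \<omega>) \<le>
    card K * measure D (B \<inter> B') + (card K * measure D B) * (card K * measure D B')"
proof -
  let ?I = "\<lambda>B i \<omega>. indicator B (x i \<omega>) :: real"
  have e: "integrable M (\<lambda>\<omega>. ?I B i \<omega> * ?I B' j \<omega>) \<and>
      expectation (\<lambda>\<omega>. ?I B i \<omega> * ?I B' j \<omega>) =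
        (if i = j then measure D (B \<inter> B') else measure D B * measure D B')" for i j
  proof (cases "i = j")
    case True
    have "(\<lambda>\<omega>. ?I B i \<omega> * ?I B' j \<omega>) = (\<lambda>\<omega>. \<Prod>i\<in>{i}. ?I (B \<inter> B') i \<omega>)"
      using True by (auto simp: indicator_def)
    then show ?thesis
      using expectation_indicators[of "{i}" "\<lambda>_. B \<inter> B'"] B True by simp
  next
    case False
    have "(\<lambda>\<omega>. ?I B i \<omega> * ?I B' j \<omega>) = (\<lambda>\<omega>. \<Prod>l\<in>{i,j}. ?I (if l = i then B else B') l \<omega>)"
      using False by simp
    then show ?thesis
      using expectation_indicators[of "{i,j}" "\<lambda>l. if l = i then B else B'"] B False by simp
  qed
  have "expectation (\<lambda>\<omega>. hits K B \<omega> * hits K B' \<omega>) =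
      (\<Sum>i\<in>K. \<Sum>j\<in>K. if i = j then measure D (B \<inter> B') else measure D B * measure D B')"
    unfolding hits_def sum_product using e by (simp add: Bochner_Integration.integral_sum)
  also have "\<dots> \<le> (\<Sum>i\<in>K. \<Sum>j\<in>K. (if i = j then measure D (B \<inter> B') else 0) + measure D B * measure D B')"
    by (intro sum_mono) auto
  also have "\<dots> = card K * measure D (B \<inter> B') + (card K * measure D B) * (card K * measure D B')"
    using K by (simp add: sum.distrib algebra_simps)
  finally show ?thesis .
qed

text \<open>
  Counts over disjoint blocks of indices are independent, so expectations of products factor.
\<close>

lemma expectation_prod_blocks:
  assumes L: "finite L" "\<And>j. j \<in> L \<Longrightarrow> finite (K j)" "disjoint_family_on K L"
    and B: "\<And>j. j \<in> L \<Longrightarrow> B j \<in> sets borel" "\<And>j. j \<in> L \<Longrightarrow> B' j \<in> sets borel"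
  shows "expectation (\<lambda>\<omega>. \<Prod>j\<in>L. hits (K j) (B j) \<omega>) = (\<Prod>j\<in>L. card (K j) * measure D (B j))"
    and "integrable M (\<lambda>\<omega>. \<Prod>j\<in>L. hits (K j) (B j) \<omega>)"
    and "expectation (\<lambda>\<omega>. \<Prod>j\<in>L. hits (K j) (B j) \<omega> * hits (K j) (B' j) \<omega>) =
      (\<Prod>j\<in>L. expectation (\<lambda>\<omega>. hits (K j) (B j) \<omega> * hits (K j) (B' j) \<omega>))"
    and "integrable M (\<lambda>\<omega>. \<Prod>j\<in>L. hits (K j) (B j) \<omega> * hits (K j) (B' j) \<omega>)"
proof -
  have ind: "indep_vars (\<lambda>j. PiM (K j) (\<lambda>_. borel)) (\<lambda>j \<omega>. restrict (\<lambda>i. x i \<omega>) (K j)) L"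
    by (rule indep_vars_restrict[OF indep]) (use L in auto)
  define h where "h j B \<psi> = (\<Sum>i\<in>K j. indicator B (\<psi> i) :: real)" for j B and \<psi> :: "nat \<Rightarrow> 'a"
  have h: "h j B (restrict (\<lambda>i. x i \<omega>) (K j)) = hits (K j) B \<omega>" for j B \<omega>
    unfolding h_def hits_def by (rule sum.cong) auto
  have hm: "h j C \<in> borel_measurable (PiM (K j) (\<lambda>_. borel))" if "C \<in> sets borel" for j C
  proof -
    note that[measurable]
    show ?thesis unfolding h_def[abs_def] by measurable
  qed
  have i1: "indep_vars (\<lambda>_. borel) (\<lambda>j \<omega>. h j (B j) (restrict (\<lambda>i. x i \<omega>) (K j))) L"
    by (rule indep_vars_compose2[OF ind]) (use B in \<open>auto intro: hm\<close>)
  have i2: "indep_vars (\<lambda>_. borel) (\<lambda>j \<omega>. (\<lambda>\<psi>. h j (B j) \<psi> * h j (B' j) \<psi>) (restrict (\<lambda>i. x i \<omega>) (K j))) L"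
    by (rule indep_vars_compose2[OF ind]) (use B in \<open>auto intro!: borel_measurable_times hm\<close>)
  note int = integrable_hits_mult[OF L(2) B]
  show "integrable M (\<lambda>\<omega>. \<Prod>j\<in>L. hits (K j) (B j) \<omega>)"
    by (rule indep_vars_integrable[OF L(1) i1[unfolded h] int(2)])
  have "expectation (\<lambda>\<omega>. \<Prod>j\<in>L. hits (K j) (B j) \<omega>) = (\<Prod>j\<in>L. expectation (hits (K j) (B j)))"
    by (rule indep_vars_lebesgue_integral[OF L(1) i1[unfolded h] int(2)])
  also have "\<dots> = (\<Prod>j\<in>L. card (K j) * measure D (B j))"
    by (rule prod.cong) (use L B in \<open>auto simp: expectation_hits\<close>)
  finally show "expectation (\<lambda>\<omega>. \<Prod>j\<in>L. hits (K j) (B j) \<omega>) = (\<Prod>j\<in>L. card (K j) * measure D (B j))" .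
  show "expectation (\<lambda>\<omega>. \<Prod>j\<in>L. hits (K j) (B j) \<omega> * hits (K j) (B' j) \<omega>) =
      (\<Prod>j\<in>L. expectation (\<lambda>\<omega>. hits (K j) (B j) \<omega> * hits (K j) (B' j) \<omega>))"
    by (rule indep_vars_lebesgue_integral[OF L(1) i2[unfolded h] int(1)])
  show "integrable M (\<lambda>\<omega>. \<Prod>j\<in>L. hits (K j) (B j) \<omega> * hits (K j) (B' j) \<omega>)"
    by (rule indep_vars_integrable[OF L(1) i2[unfolded h] int(1)])
qed

text \<open>
  A second moment argument. The index set contains disjoint blocks \<open>K j\<close>, and \<open>j\<close>-th vertices are
  taken from block \<open>j\<close> only; this makes the number of patterns at \<open>z\<close> a product of independent
  counts. Let \<open>G\<close> be the number of all patterns and \<open>W\<close> the number of patterns together with an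
  intruder in \<open>R z\<close>. If every pattern has an intruder, then \<open>G \<le> W\<close>. But \<open>G\<close> has mean \<open>\<mu>\<close> and, the
  counts at different \<open>z\<close> being negatively correlated and no cell expecting more than one hit from a
  block, variance at most \<open>2\<^sup>N \<mu>\<close>, while \<open>W\<close> has mean
  at most \<open>n \<tau> \<mu>\<close>. So Chebyshev's inequality bounds the probability of \<open>G \<le> \<mu> / 2\<close> and Markov's
  inequality that of \<open>W \<ge> \<mu> / 2\<close>, and one of these occurs if \<open>G \<le> W\<close>.
\<close>

lemma isolated_pattern_likely:
  fixes A :: "'z \<Rightarrow> nat \<Rightarrow> 'a set" and R :: "'z \<Rightarrow> 'a set" and K :: "nat \<Rightarrow> nat set"
  assumes Z: "finite Z"
    and K: "\<And>j. j < N \<Longrightarrow> K j \<subseteq> {..<n}" "disjoint_family_on K {..<N}" "\<And>j. j < N \<Longrightarrow> card (K j) = m"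
    and A[measurable]: "\<And>z j. A z j \<in> sets borel" and R[measurable]: "\<And>z. R z \<in> sets borel"
    and disj: "\<And>z z' j. z \<in> Z \<Longrightarrow> z' \<in> Z \<Longrightarrow> j < N \<Longrightarrow> z \<noteq> z' \<Longrightarrow> A z j \<inter> A z' j = {}"
    and sparse: "\<And>z j. z \<in> Z \<Longrightarrow> j < N \<Longrightarrow> real m * measure D (A z j) \<le> 1"
    and tau: "\<And>z. z \<in> Z \<Longrightarrow> measure D (R z) \<le> \<tau>"
    and mu: "\<mu> = (\<Sum>z\<in>Z. \<Prod>j<N. real m * measure D (A z j))" "0 < \<mu>"
  shows "prob {\<omega> \<in> space M. \<exists>z\<in>Z. \<exists>t\<in>Pi\<^sub>E {..<N} K. (\<forall>j<N. x (t j) \<omega> \<in> A z j) \<and>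
      (\<forall>i<n. i \<notin> t ` {..<N} \<longrightarrow> x i \<omega> \<notin> R z)} \<ge> 1 - 4 * 2 ^ N / \<mu> - 2 * (n * \<tau>)"
    (is "prob {\<omega> \<in> space M. ?S \<omega>} \<ge> _")
proof -
  let ?T = "Pi\<^sub>E {..<N} K"
  have finK: "finite (K j)" if "j < N" for j using K(1)[OF that] finite_subset by blast
  have finT: "finite ?T" by (intro finite_PiE) (auto intro: finK)
  have tau0: "0 \<le> \<tau>" if "z \<in> Z" for z using tau[OF that] measure_nonneg[of D "R z"] by linarith
  define Y where "Y z \<omega> = (\<Prod>j<N. hits (K j) (A z j) \<omega>)" for z \<omega>
  define G where "G \<omega> = (\<Sum>z\<in>Z. Y z \<omega>)" for \<omega>
  note blocks = expectation_prod_blocks[of "{..<N}" K "A z" "A z'" for z z', OF _ _ K(2)]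
  have intY: "integrable M (Y z)" and EY: "expectation (Y z) = (\<Prod>j<N. real m * measure D (A z j))" for z
    unfolding Y_def[abs_def] using blocks(1,2)[of z] finK K(3) by simp_all
  have intYY: "integrable M (\<lambda>\<omega>. Y z \<omega> * Y z' \<omega>)"
    and EYY: "expectation (\<lambda>\<omega>. Y z \<omega> * Y z' \<omega>) =
      (\<Prod>j<N. expectation (\<lambda>\<omega>. hits (K j) (A z j) \<omega> * hits (K j) (A z' j) \<omega>))" for z z'
    unfolding Y_def[abs_def] prod.distrib[symmetric] using blocks(3,4)[of z z'] finK by simp_all
  have EYY_le: "expectation (\<lambda>\<omega>. Y z \<omega> * Y z' \<omega>) \<le>
      expectation (Y z) * expectation (Y z') + (if z = z' then 2 ^ N * expectation (Y z) else 0)"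
    if z: "z \<in> Z" "z' \<in> Z" for z z'
  proof -
    have le: "expectation (\<lambda>\<omega>. hits (K j) (A z j) \<omega> * hits (K j) (A z' j) \<omega>) \<le>
        m * measure D (A z j \<inter> A z' j) + (m * measure D (A z j)) * (m * measure D (A z' j))" if "j < N" for j
      using expectation_hits_mult_le[OF finK[OF that] A A, of z j z' j] K(3)[OF that] by simp
    have ge: "0 \<le> expectation (\<lambda>\<omega>. hits (K j) (A z j) \<omega> * hits (K j) (A z' j) \<omega>)" for j
      unfolding hits_def by (intro Bochner_Integration.integral_nonneg mult_nonneg_nonneg sum_nonneg) auto
    have "expectation (\<lambda>\<omega>. Y z \<omega> * Y z' \<omega>) \<le>
        (\<Prod>j<N. m * measure D (A z j \<inter> A z' j) + (m * measure D (A z j)) * (m * measure D (A z' j)))"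
      unfolding EYY by (intro prod_mono) (use le ge in auto)
    also have "\<dots> \<le> expectation (Y z) * expectation (Y z') + (if z = z' then 2 ^ N * expectation (Y z) else 0)"
    proof (cases "z = z'")
      case False
      then show ?thesis using disj[OF z] by (simp add: EY prod.distrib)
    next
      case True
      have "(\<Prod>j<N. m * measure D (A z j) + (m * measure D (A z j)) * (m * measure D (A z j))) \<le>
          (\<Prod>j<N. 2 * (m * measure D (A z j)))"
      proof (rule prod_mono, intro conjI)
        fix j assume "j \<in> {..<N}"
        then have le1: "m * measure D (A z j) \<le> 1" using sparse z(1) by simp
        have nn: "0 \<le> m * measure D (A z j)" by simp
        show "0 \<le> m * measure D (A z j) + (m * measure D (A z j)) * (m * measure D (A z j))"
          by (intro add_nonneg_nonneg mult_nonneg_nonneg nn)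
        show "m * measure D (A z j) + (m * measure D (A z j)) * (m * measure D (A z j)) \<le> 2 * (m * measure D (A z j))"
          using mult_left_le[OF le1 nn] by linarith
      qed
      also have "\<dots> = 2 ^ N * expectation (Y z)" by (simp add: EY prod.distrib)
      also have "\<dots> \<le> expectation (Y z) * expectation (Y z) + 2 ^ N * expectation (Y z)" by simp
      finally show ?thesis using True by simp
    qed
    finally show ?thesis .
  qed
  have intG: "integrable M G" unfolding G_def[abs_def] by (intro Bochner_Integration.integrable_sum intY)
  have EG: "expectation G = \<mu>" unfolding G_def[abs_def] mu using intY EY by simp
  have GG: "G \<omega> ^ 2 = (\<Sum>z\<in>Z. \<Sum>z'\<in>Z. Y z \<omega> * Y z' \<omega>)" for \<omega>
    by (simp add: G_def power2_eq_square sum_product)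
  have intGG: "integrable M (\<lambda>\<omega>. G \<omega> ^ 2)" unfolding GG using intYY by auto
  have "expectation (\<lambda>\<omega>. G \<omega> ^ 2) = (\<Sum>z\<in>Z. \<Sum>z'\<in>Z. expectation (\<lambda>\<omega>. Y z \<omega> * Y z' \<omega>))"
    unfolding GG using intYY by (simp add: Bochner_Integration.integral_sum)
  also have "\<dots> \<le> (\<Sum>z\<in>Z. \<Sum>z'\<in>Z. expectation (Y z) * expectation (Y z') + (if z = z' then 2 ^ N * expectation (Y z) else 0))"
    by (intro sum_mono EYY_le)
  also have "\<dots> = \<mu> ^ 2 + 2 ^ N * \<mu>"
  proof -
    have "(\<Sum>z\<in>Z. \<Sum>z'\<in>Z. expectation (Y z) * expectation (Y z')) = \<mu> ^ 2"
      by (simp add: mu EY power2_eq_square sum_product)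
    moreover have "(\<Sum>z\<in>Z. \<Sum>z'\<in>Z. if z = z' then 2 ^ N * expectation (Y z) else 0) = 2 ^ N * \<mu>"
      using Z by (simp add: mu EY sum_distrib_left)
    ultimately show ?thesis by (simp only: sum.distrib)
  qed
  finally have var: "variance G \<le> 2 ^ N * \<mu>"
    using variance_eq[OF intG intGG] by (simp add: EG)
  have cheb: "prob {\<omega> \<in> space M. \<mu> / 2 \<le> \<bar>G \<omega> - \<mu>\<bar>} \<le> 4 * 2 ^ N / \<mu>"
  proof -
    have "prob {\<omega> \<in> space M. \<mu> / 2 \<le> \<bar>G \<omega> - \<mu>\<bar>} \<le> variance G / (\<mu> / 2)\<^sup>2"
      using Chebyshev_inequality[of G "\<mu> / 2"] intG intGG mu(2) by (simp add: EG)
    also have "\<dots> \<le> 2 ^ N * \<mu> / (\<mu> / 2)\<^sup>2" by (intro divide_right_mono var) simp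
    also have "\<dots> = 4 * 2 ^ N / \<mu>" using mu(2) by (simp add: power2_eq_square field_simps)
    finally show ?thesis .
  qed
  define \<xi> where "\<xi> z t \<omega> = (\<Prod>j<N. indicator (A z j) (x (t j) \<omega>) :: real)" for z t \<omega>
  define W where "W \<omega> = (\<Sum>z\<in>Z. \<Sum>t\<in>?T. \<Sum>i\<in>{..<n} - t ` {..<N}. \<xi> z t \<omega> * indicator (R z) (x i \<omega>))" for \<omega>
  \<comment> \<open>expanding the product of the counts: \<open>t\<close> picks one index from each block\<close>
  have G_alt: "G \<omega> = (\<Sum>z\<in>Z. \<Sum>t\<in>?T. \<xi> z t \<omega>)" for \<omega>
    unfolding G_def Y_def \<xi>_def hits_def by (intro sum.cong refl prod_sum_PiE) (auto intro: finK)
  have inj: "inj_on t {..<N}" if t: "t \<in> ?T" for t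
  proof (rule inj_onI, rule ccontr)
    fix i j assume ij: "i \<in> {..<N}" "j \<in> {..<N}" "t i = t j" "i \<noteq> j"
    then have "t i \<in> K i" "t i \<in> K j" using PiE_mem[OF t] by (metis, metis)
    then show False using K(2) ij by (auto simp: disjoint_family_on_def)
  qed
  have E\<xi>: "integrable M (\<lambda>\<omega>. \<xi> z t \<omega> * indicator (R z) (x i \<omega>)) \<and>
      expectation (\<lambda>\<omega>. \<xi> z t \<omega> * indicator (R z) (x i \<omega>)) = (\<Prod>j<N. measure D (A z j)) * measure D (R z)"
    if t: "t \<in> ?T" and i: "i \<notin> t ` {..<N}" for z t i
  proof -
    define B where "B l = (if l = i then R z else A z (the_inv_into {..<N} t l))" for l
    have B: "B (t j) = A z j" if "j < N" for j
      using that i the_inv_into_f_f[OF inj[OF t]] by (auto simp: B_def)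
    have Bi: "B i = R z" by (simp add: B_def)
    have Bm: "B l \<in> sets borel" for l by (simp add: B_def)
    have p: "(\<Prod>l\<in>insert i (t ` {..<N}). h (B l) l) = (\<Prod>j<N. h (A z j) (t j)) * (h (R z) i :: real)" for h
      using i by (simp add: prod.reindex[OF inj[OF t]] B Bi)
    show ?thesis
      using expectation_indicators[of "insert i (t ` {..<N})" B] Bm
        p[of "\<lambda>C l. indicator C (x l \<omega>)" for \<omega>] p[of "\<lambda>C l. measure D C"]
      by (simp add: \<xi>_def)
  qed
  have intW: "integrable M W" unfolding W_def[abs_def] using E\<xi> by (intro Bochner_Integration.integrable_sum) auto
  have cardT: "real (card ?T) = real m ^ N" using K(3) by (simp add: card_PiE)
  have "expectation W = (\<Sum>z\<in>Z. expectation (\<lambda>\<omega>. \<Sum>t\<in>?T. \<Sum>i\<in>{..<n} - t ` {..<N}. \<xi> z t \<omega> * indicator (R z) (x i \<omega>)))"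
    unfolding W_def[abs_def]
    by (intro Bochner_Integration.integral_sum Bochner_Integration.integrable_sum) (use E\<xi> in auto)
  also have "\<dots> = (\<Sum>z\<in>Z. \<Sum>t\<in>?T. expectation (\<lambda>\<omega>. \<Sum>i\<in>{..<n} - t ` {..<N}. \<xi> z t \<omega> * indicator (R z) (x i \<omega>)))"
    by (intro sum.cong refl Bochner_Integration.integral_sum Bochner_Integration.integrable_sum) (use E\<xi> in auto)
  also have "\<dots> = (\<Sum>z\<in>Z. \<Sum>t\<in>?T. \<Sum>i\<in>{..<n} - t ` {..<N}. expectation (\<lambda>\<omega>. \<xi> z t \<omega> * indicator (R z) (x i \<omega>)))"
    by (intro sum.cong refl Bochner_Integration.integral_sum Bochner_Integration.integrable_sum) (use E\<xi> in auto)
  also have "\<dots> = (\<Sum>z\<in>Z. \<Sum>t\<in>?T. \<Sum>i\<in>{..<n} - t ` {..<N}. (\<Prod>j<N. measure D (A z j)) * measure D (R z))"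
    by (intro sum.cong refl) (use E\<xi> in auto)
  also have "\<dots> \<le> (\<Sum>z\<in>Z. \<Sum>t\<in>?T. \<Sum>i<n. (\<Prod>j<N. measure D (A z j)) * \<tau>)"
  proof (intro sum_mono)
    fix z t assume z: "z \<in> Z"
    let ?p = "\<Prod>j<N. measure D (A z j)"
    have p: "0 \<le> ?p" by (intro prod_nonneg) simp
    have "(\<Sum>i\<in>{..<n} - t ` {..<N}. ?p * measure D (R z)) \<le> (\<Sum>i\<in>{..<n} - t ` {..<N}. ?p * \<tau>)"
      by (intro sum_mono mult_left_mono tau z p)
    also have "\<dots> \<le> (\<Sum>i<n. ?p * \<tau>)"
      by (rule sum_mono2) (use p tau0[OF z] in auto)
    finally show "(\<Sum>i\<in>{..<n} - t ` {..<N}. ?p * measure D (R z)) \<le> (\<Sum>i<n. ?p * \<tau>)" .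
  qed
  also have "\<dots> = n * \<tau> * \<mu>"
    unfolding mu using cardT by (simp add: prod.distrib sum_distrib_left sum_distrib_right mult_ac)
  finally have EW: "expectation W \<le> n * \<tau> * \<mu>" .
  have W0: "0 \<le> W \<omega>" for \<omega> unfolding W_def \<xi>_def by (intro sum_nonneg mult_nonneg_nonneg prod_nonneg) auto
  have mark: "prob {\<omega> \<in> space M. \<mu> / 2 \<le> W \<omega>} \<le> 2 * (n * \<tau>)"
  proof -
    have "prob {\<omega> \<in> space M. \<mu> / 2 \<le> W \<omega>} \<le> expectation W / (\<mu> / 2)"
      by (rule integral_Markov_inequality_measure[where A="{}"]) (use intW W0 mu(2) in auto)
    also have "\<dots> \<le> n * \<tau> * \<mu> / (\<mu> / 2)" using mu(2) by (intro divide_right_mono EW) simp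
    also have "\<dots> = 2 * (n * \<tau>)" using mu(2) by simp
    finally show ?thesis .
  qed
  have [measurable]: "G \<in> borel_measurable M" "W \<in> borel_measurable M" using intG intW by auto
  have S_meas[measurable]: "{\<omega> \<in> space M. ?S \<omega>} \<in> events"
  proof -
    have "{\<omega> \<in> space M. ?S \<omega>} = {\<omega> \<in> space M. \<exists>z\<in>Z. \<exists>t\<in>?T. (\<forall>j\<in>{..<N}. x (t j) \<omega> \<in> A z j) \<and>
      (\<forall>i\<in>{..<n} - t ` {..<N}. x i \<omega> \<notin> R z)}"
      by (intro Collect_cong conj_cong refl bex_cong) auto
    also have "\<dots> \<in> events"
      by (intro sets.sets_Collect_finite_Ex sets.sets_Collect_conj sets.sets_Collect_finite_All Z finT
          finite_Diff finite_lessThan) measurable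
    finally show ?thesis .
  qed
  have fail: "W \<omega> \<ge> G \<omega>" if "\<not> ?S \<omega>" for \<omega>
    unfolding W_def G_alt
  proof (intro sum_mono)
    fix z t assume z: "z \<in> Z" and t: "t \<in> ?T"
    have nn: "0 \<le> \<xi> z t \<omega> * indicator (R z) (x i \<omega>)" for i
      unfolding \<xi>_def by (intro mult_nonneg_nonneg prod_nonneg) auto
    show "\<xi> z t \<omega> \<le> (\<Sum>i\<in>{..<n} - t ` {..<N}. \<xi> z t \<omega> * indicator (R z) (x i \<omega>))"
    proof (cases "\<forall>j<N. x (t j) \<omega> \<in> A z j")
      case True
      then obtain i where i: "i \<in> {..<n} - t ` {..<N}" "x i \<omega> \<in> R z" using \<open>\<not> ?S \<omega>\<close> z t by blast
      then have "\<xi> z t \<omega> = \<xi> z t \<omega> * indicator (R z) (x i \<omega>)" by simp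
      also have "\<dots> \<le> (\<Sum>i\<in>{..<n} - t ` {..<N}. \<xi> z t \<omega> * indicator (R z) (x i \<omega>))"
        by (rule member_le_sum[OF i(1)]) (use nn in auto)
      finally show ?thesis .
    next
      case False
      then obtain j where "j < N" "x (t j) \<omega> \<notin> A z j" by blast
      then have "\<xi> z t \<omega> = 0" unfolding \<xi>_def by (intro prod_zero bexI[of _ j]) auto
      then show ?thesis using nn by (simp add: sum_nonneg)
    qed
  qed
  have "space M - {\<omega> \<in> space M. ?S \<omega>} \<subseteq>
      {\<omega> \<in> space M. \<mu> / 2 \<le> \<bar>G \<omega> - \<mu>\<bar>} \<union> {\<omega> \<in> space M. \<mu> / 2 \<le> W \<omega>}"
  proof
    fix \<omega> assume "\<omega> \<in> space M - {\<omega> \<in> space M. ?S \<omega>}"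
    then have "\<omega> \<in> space M" "G \<omega> \<le> W \<omega>" using fail by auto
    moreover from this(2) have "\<mu> / 2 \<le> \<bar>G \<omega> - \<mu>\<bar> \<or> \<mu> / 2 \<le> W \<omega>"
      using abs_ge_minus_self[of "G \<omega> - \<mu>"] by linarith
    ultimately show "\<omega> \<in> {\<omega> \<in> space M. \<mu> / 2 \<le> \<bar>G \<omega> - \<mu>\<bar>} \<union> {\<omega> \<in> space M. \<mu> / 2 \<le> W \<omega>}" by auto
  qed
  then have "prob (space M - {\<omega> \<in> space M. ?S \<omega>}) \<le>
      prob ({\<omega> \<in> space M. \<mu> / 2 \<le> \<bar>G \<omega> - \<mu>\<bar>} \<union> {\<omega> \<in> space M. \<mu> / 2 \<le> W \<omega>})"
    by (intro finite_measure_mono) measurable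
  also have "\<dots> \<le> prob {\<omega> \<in> space M. \<mu> / 2 \<le> \<bar>G \<omega> - \<mu>\<bar>} + prob {\<omega> \<in> space M. \<mu> / 2 \<le> W \<omega>}"
    by (rule measure_Un_le) measurable
  also have "\<dots> \<le> 4 * 2 ^ N / \<mu> + 2 * (n * \<tau>)" by (rule add_mono[OF cheb mark])
  finally show ?thesis using prob_compl[OF S_meas] by simp
qed

end

section \<open>Lattice cubes and sets of positive measure\<close>

definition cell :: "real \<Rightarrow> int ^ 'd \<Rightarrow> (real ^ 'd) set" where
  "cell s z = {p. \<forall>i. \<lfloor>p $ i / s\<rfloor> = z $ i}"

text \<open>
  For \<open>0 < s\<close> the half-open cube \<open>cell s z\<close> has side \<open>s\<close> and least vertex \<open>s *\<^sub>R corner z\<close>.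
\<close>

definition corner :: "int ^ 'd \<Rightarrow> real ^ 'd" where
  "corner z = (\<chi> i. real_of_int (z $ i))"

lemma corner_add: "corner (z + a) = corner z + corner a"
  by (simp add: corner_def vec_eq_iff)

lemma cell_disjoint: "z \<noteq> z' \<Longrightarrow> cell s z \<inter> cell s z' = {}"
  by (auto simp: cell_def vec_eq_iff)

lemma in_some_cell: "\<exists>z. p \<in> cell s z"
  by (rule exI[of _ "\<chi> i. \<lfloor>p $ i / s\<rfloor>"]) (simp add: cell_def)

lemma mem_cell_iff:
  "0 < s \<Longrightarrow> p \<in> cell s z \<longleftrightarrow> (\<forall>i. s * z $ i \<le> p $ i \<and> p $ i < s * (z $ i + 1))"
  unfolding cell_def floor_eq_iff by (simp add: field_simps)

lemma sets_cell [measurable]: "cell s z \<in> sets borel"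
proof -
  have "cell s z = (\<Inter>i\<in>UNIV. {p. \<lfloor>p $ i / s\<rfloor> = z $ i})" by (auto simp: cell_def)
  moreover have "{p::real^'a. \<lfloor>p $ i / s\<rfloor> = z $ i} \<in> sets borel" for i
    unfolding floor_eq_iff by measurable
  ultimately show ?thesis by auto
qed

lemma emeasure_cell:
  fixes z :: "int ^ 'd"
  assumes s: "0 < s"
  shows "emeasure lborel (cell s z) = ennreal (s ^ CARD('d))"
proof -
  define l u :: "real ^ 'd" where "l = s *\<^sub>R corner z" and "u = (\<chi> i. s * (z $ i + 1))"
  have lu: "l \<bullet> b \<le> u \<bullet> b" if "b \<in> Basis" for b
    using that s by (auto simp: Basis_vec_def inner_axis l_def u_def corner_def algebra_simps)
  have len: "(u - l) \<bullet> b = s" if "b \<in> Basis" for b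
    using that s by (auto simp: Basis_vec_def inner_axis l_def u_def corner_def algebra_simps)
  show ?thesis
  proof (rule antisym)
    have "emeasure lborel (cell s z) \<le> emeasure lborel (cbox l u)"
      by (rule emeasure_mono) (auto simp: mem_cell_iff[OF s] mem_box_cart l_def u_def corner_def less_imp_le)
    then show "emeasure lborel (cell s z) \<le> ennreal (s ^ CARD('d))"
      using lu len by (simp add: emeasure_lborel_cbox)
    have "emeasure lborel (box l u) \<le> emeasure lborel (cell s z)"
      by (rule emeasure_mono) (auto simp: mem_cell_iff[OF s] mem_box_cart l_def u_def corner_def less_imp_le)
    then show "ennreal (s ^ CARD('d)) \<le> emeasure lborel (cell s z)"
      using lu len by (simp add: emeasure_lborel_box)
  qed
qed

lemma cell_lmeasurable: "0 < s \<Longrightarrow> cell s z \<in> lmeasurable"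
  by (rule fmeasurableI) (auto simp: emeasure_cell)

lemma measure_cell: "0 < s \<Longrightarrow> measure lborel (cell s z :: (real ^ 'd) set) = s ^ CARD('d)"
  by (simp add: measure_def emeasure_cell)

lemma dist_corner:
  fixes p :: "real ^ 'd"
  assumes s: "0 < s" and p: "p \<in> cell s z"
  shows "dist p (s *\<^sub>R corner z) \<le> s * CARD('d)"
proof -
  have "\<bar>(p - s *\<^sub>R corner z) $ i\<bar> \<le> s" for i
  proof -
    have "s * z $ i \<le> p $ i" "p $ i < s * (z $ i + 1)" using p by (auto simp: mem_cell_iff[OF s])
    then show ?thesis by (simp add: corner_def algebra_simps)
  qed
  then have "(\<Sum>i\<in>UNIV. \<bar>(p - s *\<^sub>R corner z) $ i\<bar>) \<le> (\<Sum>i\<in>(UNIV::'d set). s)" by (intro sum_mono)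
  then show ?thesis
    using norm_le_l1_cart[of "p - s *\<^sub>R corner z"] by (simp add: dist_norm mult.commute)
qed

lemma measure_UN_cells:
  fixes G :: "(int ^ 'd) set"
  assumes "0 < s" "finite G" "T \<in> sets lebesgue"
  shows "measure lebesgue ((\<Union>w\<in>G. cell s w) \<inter> T) = (\<Sum>w\<in>G. measure lebesgue (cell s w \<inter> T))"
proof -
  have eq: "(\<Union>w\<in>G. cell s w) \<inter> T = (\<Union>w\<in>G. cell s w \<inter> T)" by blast
  show ?thesis
    unfolding eq
  proof (rule measure_finite_Union)
    show "disjoint_family_on (\<lambda>w. cell s w \<inter> T) G"
      using cell_disjoint by (fastforce simp: disjoint_family_on_def)
    show "emeasure lebesgue (cell s w \<inter> T) \<noteq> \<infinity>" for w
      unfolding infinity_ennreal_def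
      by (rule fmeasurableD2[OF fmeasurable_Int_fmeasurable[OF cell_lmeasurable[OF assms(1)] assms(3)]])
  qed (use assms in auto)
qed

lemma finite_cells_within:
  fixes U :: "(real ^ 'd) set"
  assumes s: "0 < s" and U: "U \<in> lmeasurable"
  shows "finite {w. cell s w \<subseteq> U}"
proof -
  have sd: "0 < s ^ CARD('d)" using s by simp
  have "card G \<le> nat \<lceil>measure lebesgue U / s ^ CARD('d)\<rceil>" if G: "G \<subseteq> {w. cell s w \<subseteq> U}" "finite G" for G
  proof -
    have "card G * s ^ CARD('d) = measure lebesgue (\<Union>w\<in>G. cell s w)"
      using measure_UN_cells[OF s G(2), of UNIV] s by (simp add: measure_cell)
    also have "\<dots> \<le> measure lebesgue U"
      by (rule measure_mono_fmeasurable) (use G U in auto)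
    finally have "real (card G) \<le> measure lebesgue U / s ^ CARD('d)" using sd by (simp add: field_simps)
    then show ?thesis by linarith
  qed
  then show ?thesis using finite_if_finite_subsets_card_bdd by blast
qed

text \<open>
  A substitute for the Lebesgue density theorem: an open \<open>U\<close> that barely exceeds \<open>S\<close>, and a part \<open>S'\<close>
  of \<open>S\<close> of at least half the measure that keeps a fixed distance from the complement of \<open>U\<close>. For
  \<open>S'\<close> one takes the points of \<open>S\<close> with \<open>ball p e \<subseteq> U\<close>; they exhaust \<open>S\<close> as \<open>e\<close> tends to \<open>0\<close>.
\<close>

lemma density_core:
  fixes S :: "(real ^ 'd) set"
  assumes S: "S \<in> lmeasurable" "0 < measure lebesgue S" and \<eta>: "0 < \<eta>"
  obtains U S' e where "S' \<subseteq> S" "S \<subseteq> U" "U \<in> lmeasurable" "S' \<in> lmeasurable"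
    "measure lebesgue (U - S) < \<eta>" "measure lebesgue S / 2 < measure lebesgue S'"
    "0 < e" "\<And>p. p \<in> S' \<Longrightarrow> ball p e \<subseteq> U"
proof -
  obtain U where U: "open U" "S \<subseteq> U" "U - S \<in> lmeasurable" "emeasure lebesgue (U - S) < ennreal \<eta>"
    using sets_lebesgue_outer_open[OF fmeasurableD[OF S(1)] \<eta>] by blast
  have "S \<union> (U - S) \<in> lmeasurable" by (rule fmeasurable.Un[OF S(1) U(3)])
  moreover have "S \<union> (U - S) = U" using U(2) by blast
  ultimately have Um: "U \<in> lmeasurable" by simp
  have eta: "measure lebesgue (U - S) < \<eta>"
    using U(3,4) \<eta> by (simp add: emeasure_eq_measure2 ennreal_less_iff)
  define D where "D n = {p. ball p (1 / Suc n) \<subseteq> U}" for n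
  have D_closed: "closed (D n)" for n
  proof -
    have "- D n = (\<Union>q\<in>-U. ball q (1 / Suc n))"
      by (auto simp: D_def subset_iff dist_commute)
    then show ?thesis by (metis closed_def open_UN open_ball)
  qed
  have D_inc: "incseq (\<lambda>n. S \<inter> D n)"
  proof (rule incseq_SucI)
    fix n
    have "1 / real (Suc (Suc n)) \<le> 1 / real (Suc n)" by (simp add: frac_le)
    then have "ball p (1 / Suc (Suc n)) \<subseteq> ball p (1 / Suc n)" for p :: "real ^ 'd" by (rule subset_ball)
    then show "S \<inter> D n \<subseteq> S \<inter> D (Suc n)" by (auto simp: D_def)
  qed
  have UN: "(\<Union>n. S \<inter> D n) = S"
  proof (intro equalityI subsetI)
    fix p assume p: "p \<in> S"
    then obtain e where e: "0 < e" "ball p e \<subseteq> U" using U(1,2) openE by blast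
    obtain n where "1 / real (Suc n) < e" using e(1) nat_approx_posE by blast
    then have "ball p (1 / Suc n) \<subseteq> ball p e" by (intro subset_ball) simp
    then show "p \<in> (\<Union>n. S \<inter> D n)" using e p by (auto simp: D_def)
  qed auto
  have Dm: "S \<inter> D n \<in> lmeasurable" for n
    using fmeasurable_Int_fmeasurable[OF S(1)] D_closed by auto
  have "(\<lambda>n. measure lebesgue (S \<inter> D n)) \<longlonglongrightarrow> measure lebesgue (\<Union>n. S \<inter> D n)"
    by (rule Lim_measure_incseq) (use Dm D_inc fmeasurableD2[OF S(1)] UN in auto)
  then have "\<forall>\<^sub>F n in sequentially. measure lebesgue S / 2 < measure lebesgue (S \<inter> D n)"
    unfolding UN by (rule order_tendstoD) (use S(2) in simp)
  then obtain n where n: "measure lebesgue S / 2 < measure lebesgue (S \<inter> D n)"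
    using eventually_happens'[OF sequentially_bot] by blast
  show thesis
    by (rule that[of "S \<inter> D n" U "1 / Suc n"]) (use U Um eta n Dm in \<open>auto simp: D_def\<close>)
qed

text \<open>
  For small \<open>s\<close> there are about \<open>s\<^sup>-\<^sup>d\<close> positions \<open>z\<close> such that \<open>S\<close> fills at least half of each of the
  \<open>N\<close> cells \<open>z + a j\<close>. All cells that meet \<open>S'\<close>, and their translates by \<open>a j\<close>, lie in \<open>U\<close>. A
  cell in \<open>U\<close> that is not half filled wastes at least half of its volume on \<open>U - S\<close>, so there are few of them, and each
  spoils at most \<open>N\<close> positions.
\<close>

lemma many_full_cells:
  fixes S :: "(real ^ 'd) set" and a :: "nat \<Rightarrow> int ^ 'd" and N :: nat
  assumes S: "S \<in> lmeasurable" "0 < measure lebesgue S"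
  obtains \<gamma> s0 :: real where "0 < \<gamma>" "0 < s0"
    "\<And>s::real. 0 < s \<Longrightarrow> s < s0 \<Longrightarrow> \<exists>Z. finite Z \<and> \<gamma> \<le> card Z * s ^ CARD('d) \<and>
       (\<forall>z\<in>Z. \<forall>j<N. s ^ CARD('d) / 2 \<le> measure lebesgue (cell s (z + a j) \<inter> S))"
proof -
  define \<mu> where "\<mu> = measure lebesgue S"
  \<comment> \<open>the spoilt positions then have total volume at most \<open>N * (2 * \<eta>) \<le> \<mu> / 4\<close>\<close>
  define \<eta> where "\<eta> = \<mu> / (8 * (N + 1))"
  have \<mu>: "0 < \<mu>" and \<eta>: "0 < \<eta>" using S(2) by (auto simp: \<mu>_def \<eta>_def)
  obtain U S' e where U: "S' \<subseteq> S" "S \<subseteq> U" "U \<in> lmeasurable" "S' \<in> lmeasurable"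
    "measure lebesgue (U - S) < \<eta>" "\<mu> / 2 < measure lebesgue S'"
    "0 < e" "\<And>p. p \<in> S' \<Longrightarrow> ball p e \<subseteq> U"
    using density_core[OF S \<eta>] unfolding \<mu>_def by metis
  define A where "A = (\<Sum>j<N. norm (corner (a j)))"
  define s0 where "s0 = e / (2 * CARD('d) + A + 1)"
  have A0: "0 \<le> A" by (simp add: A_def sum_nonneg)
  have s0: "0 < s0" using U(7) A0 by (auto simp: s0_def intro!: divide_pos_pos add_nonneg_pos)
  have main: "\<exists>Z. finite Z \<and> \<mu> / 4 \<le> card Z * s ^ CARD('d) \<and>
       (\<forall>z\<in>Z. \<forall>j<N. s ^ CARD('d) / 2 \<le> measure lebesgue (cell s (z + a j) \<inter> S))"
    if s: "0 < s" "s < s0" for s :: real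
  proof -
    define v where "v = s ^ CARD('d)"
    have v: "0 < v" using s by (simp add: v_def)
    \<comment> \<open>\<open>Z0\<close>: positions near \<open>S'\<close>; \<open>NF\<close>: cells in \<open>U\<close> that are not half full; \<open>Z\<close>: usable positions\<close>
    define Z0 where "Z0 = {z. cell s z \<inter> S' \<noteq> {}}"
    define NF where "NF = {w. cell s w \<subseteq> U \<and> measure lebesgue (cell s w \<inter> S) < v / 2}"
    define Z where "Z = {z\<in>Z0. \<forall>j<N. z + a j \<notin> NF}"
    have near: "cell s (z + b) \<subseteq> U" if z: "z \<in> Z0" and b: "norm (corner b) \<le> A" for z b
    proof
      fix q assume q: "q \<in> cell s (z + b)"
      obtain p where p: "p \<in> cell s z" "p \<in> S'" using z by (auto simp: Z0_def)
      have "dist p q \<le> dist p (s *\<^sub>R corner z) + dist (s *\<^sub>R corner z) (s *\<^sub>R corner (z + b)) + dist (s *\<^sub>R corner (z + b)) q"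
        by metric
      also have "dist (s *\<^sub>R corner z) (s *\<^sub>R corner (z + b)) = s * norm (corner b)"
        using s by (simp add: corner_add dist_norm scaleR_add_right)
      also have "dist p (s *\<^sub>R corner z) + s * norm (corner b) + dist (s *\<^sub>R corner (z + b)) q
          \<le> s * CARD('d) + s * A + s * CARD('d)"
        using dist_corner[OF s(1) p(1)] dist_corner[OF s(1) q] b s
        by (intro add_mono) (auto simp: dist_commute)
      also have "\<dots> < s * (2 * CARD('d) + A + 1)" using s by (simp add: algebra_simps)
      also have "\<dots> < s0 * (2 * CARD('d) + A + 1)"
        using s A0 by (intro mult_strict_right_mono) auto
      also have "\<dots> = e" using A0 by (simp add: s0_def)
      finally show "q \<in> U" using U(8)[OF p(2)] by auto
    qed
    have finW: "finite {w. cell s w \<subseteq> U}" by (rule finite_cells_within[OF s(1) U(3)])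
    have "Z0 \<subseteq> {w. cell s w \<subseteq> U}" using near[of _ 0] A0 by (auto simp: corner_def zero_vec_def[symmetric])
    then have finZ0: "finite Z0" using finW finite_subset by blast
    have finNF: "finite NF" unfolding NF_def using finW by (rule rev_finite_subset) auto
    have Ssets: "S \<in> sets lebesgue" "S' \<in> sets lebesgue" "U \<in> sets lebesgue" using S U by auto
    have "\<mu> / 2 < measure lebesgue S'" by (rule U(6))
    also have "S' = (\<Union>z\<in>Z0. cell s z) \<inter> S'"
      using in_some_cell[of _ s] by (fastforce simp: Z0_def)
    also have "measure lebesgue \<dots> = (\<Sum>z\<in>Z0. measure lebesgue (cell s z \<inter> S'))"
      by (rule measure_UN_cells[OF s(1) finZ0 Ssets(2)])
    also have "\<dots> \<le> (\<Sum>z\<in>Z0. v)"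
    proof (rule sum_mono)
      fix z
      have "measure lebesgue (cell s z \<inter> S') \<le> measure lebesgue (cell s z)"
        by (rule measure_mono_fmeasurable) (use cell_lmeasurable[OF s(1)] Ssets in auto)
      then show "measure lebesgue (cell s z \<inter> S') \<le> v" using s by (simp add: v_def measure_cell)
    qed
    finally have cardZ0: "\<mu> / 2 < card Z0 * v" by simp
    have "card NF * (v / 2) = (\<Sum>w\<in>NF. v / 2)" by simp
    also have "\<dots> \<le> (\<Sum>w\<in>NF. measure lebesgue (cell s w \<inter> (U - S)))"
    proof (rule sum_mono)
      fix w assume w: "w \<in> NF"
      have "measure lebesgue (cell s w \<inter> (U - S)) = measure lebesgue (cell s w - cell s w \<inter> S)"
        using w by (intro arg_cong[where f="measure lebesgue"]) (auto simp: NF_def)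
      also have "\<dots> = measure lebesgue (cell s w) - measure lebesgue (cell s w \<inter> S)"
        by (rule measurable_measure_Diff) (use cell_lmeasurable[OF s(1)] Ssets in auto)
      also have "\<dots> \<ge> v / 2" using w s by (simp add: NF_def v_def measure_cell)
      finally show "v / 2 \<le> measure lebesgue (cell s w \<inter> (U - S))" .
    qed
    also have "\<dots> = measure lebesgue ((\<Union>w\<in>NF. cell s w) \<inter> (U - S))"
      by (rule measure_UN_cells[symmetric, OF s(1) finNF]) (use Ssets in auto)
    also have "\<dots> \<le> measure lebesgue (U - S)"
      by (rule measure_mono_fmeasurable) (use finNF Ssets U(3) in \<open>auto intro!: fmeasurable_Diff\<close>)
    also have "\<dots> < \<eta>" by (rule U(5))
    finally have cardNF: "card NF * v < 2 * \<eta>" by simp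
    have "Z0 - Z \<subseteq> (\<Union>j<N. (\<lambda>w. w - a j) ` NF)" by (force simp: Z_def image_iff)
    then have "card (Z0 - Z) \<le> card (\<Union>j<N. (\<lambda>w. w - a j) ` NF)" by (intro card_mono) (use finNF in auto)
    also have "\<dots> \<le> (\<Sum>j<N. card ((\<lambda>w. w - a j) ` NF))" by (rule card_UN_le) simp
    also have "\<dots> \<le> (\<Sum>j<N. card NF)" by (intro sum_mono card_image_le finNF)
    finally have "card (Z0 - Z) \<le> N * card NF" by simp
    then have "real (card (Z0 - Z)) \<le> real N * real (card NF)" by (metis of_nat_le_iff of_nat_mult)
    then have "card (Z0 - Z) * v \<le> N * (card NF * v)" using v by (simp add: mult_right_mono flip: mult.assoc)
    also have "\<dots> \<le> N * (2 * \<eta>)" using cardNF by (intro mult_left_mono) auto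
    also have "\<dots> \<le> \<mu> / 4" using \<mu> by (simp add: \<eta>_def field_simps)
    finally have "card (Z0 - Z) * v \<le> \<mu> / 4" .
    moreover have "card Z0 = card Z + card (Z0 - Z)"
    proof -
      have "Z \<subseteq> Z0" by (auto simp: Z_def)
      then show ?thesis
        using finZ0 card_Diff_subset[of Z Z0] card_mono[of Z0 Z] finite_subset[of Z Z0] by simp
    qed
    ultimately have "\<mu> / 4 \<le> card Z * v" using cardZ0 by (simp add: algebra_simps)
    moreover have "finite Z" using finZ0 by (simp add: Z_def)
    moreover have "v / 2 \<le> measure lebesgue (cell s (z + a j) \<inter> S)" if "z \<in> Z" "j < N" for z j
    proof -
      have "norm (corner (a j)) \<le> A"
        unfolding A_def using that by (intro member_le_sum) auto
      then have "cell s (z + a j) \<subseteq> U" using near[of z "a j"] that by (auto simp: Z_def)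
      then show ?thesis using that by (auto simp: Z_def NF_def not_less)
    qed
    ultimately show ?thesis
      unfolding v_def by blast
  qed
  show thesis
    by (rule that[OF _ s0 main]) (use \<mu> in auto)
qed

lemma density_level_set:
  fixes f :: "'a::euclidean_space \<Rightarrow> real"
  assumes f: "\<And>p. 0 \<le> f p" "integrable lebesgue f" "integral\<^sup>L lebesgue f \<noteq> 0"
  obtains \<epsilon> S where "0 < \<epsilon>" "S \<in> lmeasurable" "0 < measure lebesgue S" "\<And>p. p \<in> S \<Longrightarrow> \<epsilon> \<le> f p"
proof -
  have [measurable]: "f \<in> borel_measurable lebesgue" using f(2) by auto
  define S where "S n = {p \<in> space lebesgue. 1 / real (Suc n) \<le> f p}" for n
  have [measurable]: "S n \<in> sets lebesgue" for n unfolding S_def by measurable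
  have "\<exists>n. emeasure lebesgue (S n) \<noteq> 0"
  proof (rule ccontr)
    assume "\<not> ?thesis"
    then have "AE p in lebesgue. p \<notin> S n" for n
      by (intro AE_not_in) (auto intro!: null_setsI)
    then have "AE p in lebesgue. \<forall>n. p \<notin> S n" by (simp add: AE_all_countable)
    then have "AE p in lebesgue. f p = 0"
    proof (rule AE_mp, intro AE_I2 impI)
      fix p assume p: "\<forall>n. p \<notin> S n"
      show "f p = 0"
      proof (rule ccontr)
        assume "f p \<noteq> 0"
        then have "0 < f p" using f(1)[of p] by simp
        then obtain n where "1 / real (Suc n) < f p" using nat_approx_posE by blast
        then have "p \<in> S n" by (simp add: S_def)
        then show False using p by simp
      qed
    qed
    then have "integral\<^sup>L lebesgue f = 0" by (rule integral_eq_zero_AE)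
    then show False using f(3) by simp
  qed
  then obtain n where n: "emeasure lebesgue (S n) \<noteq> 0" by blast
  have "emeasure lebesgue (S n) \<le> ennreal ((1 / (1 / real (Suc n))) * integral\<^sup>L lebesgue f)"
    unfolding S_def by (rule integral_Markov_inequality[OF f(2)]) (use f(1) in auto)
  then have "emeasure lebesgue (S n) < \<infinity>" using le_less_trans ennreal_less_top by fastforce
  then have fm: "S n \<in> lmeasurable" by (intro fmeasurableI) auto
  show thesis
  proof (rule that[of "1 / real (Suc n)" "S n"])
    show "0 < measure lebesgue (S n)" using n fm by (simp add: emeasure_eq_measure2 zero_less_measure_iff)
  qed (use fm in \<open>auto simp: S_def\<close>)
qed

lemma emeasure_density_ge:
  assumes "f \<in> borel_measurable M" "A \<in> sets M" "S \<in> sets M" "\<And>p. p \<in> S \<Longrightarrow> ennreal \<epsilon> \<le> f p"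
  shows "ennreal \<epsilon> * emeasure M (A \<inter> S) \<le> emeasure (density M f) A"
proof -
  have "ennreal \<epsilon> * emeasure M (A \<inter> S) = (\<integral>\<^sup>+p. ennreal \<epsilon> * indicator (A \<inter> S) p \<partial>M)"
    using assms by (simp add: nn_integral_cmult_indicator)
  also have "\<dots> \<le> (\<integral>\<^sup>+p. f p * indicator A p \<partial>M)"
    by (intro nn_integral_mono) (use assms in \<open>auto simp: indicator_def\<close>)
  also have "\<dots> = emeasure (density M f) A" using assms by (simp add: emeasure_density)
  finally show ?thesis .
qed

lemma emeasure_density_le:
  assumes "f \<in> borel_measurable M" "A \<in> sets M" "\<And>p. f p \<le> B"
  shows "emeasure (density M f) A \<le> B * emeasure M A"
proof -
  have "emeasure (density M f) A = (\<integral>\<^sup>+p. f p * indicator A p \<partial>M)"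
    using assms by (simp add: emeasure_density)
  also have "\<dots> \<le> (\<integral>\<^sup>+p. B * indicator A p \<partial>M)"
    by (intro nn_integral_mono) (use assms in \<open>auto simp: indicator_def\<close>)
  also have "\<dots> = B * emeasure M A" using assms by (simp add: nn_integral_cmult_indicator)
  finally show ?thesis .
qed

section \<open>Bounds on the probability of nontrivial homology\<close>

locale bounded_iid_points = iid_points M x D
  for M :: "'w measure" and x :: "nat \<Rightarrow> 'w \<Rightarrow> real ^ 'd" and D +
  fixes B :: real
  assumes B: "0 \<le> B" and upper: "\<And>A. A \<in> sets borel \<Longrightarrow> emeasure D A \<le> ennreal B * emeasure lborel A"
begin

lemma measure_D_le:
  assumes "A \<in> sets borel" "emeasure lborel A = ennreal v" "0 \<le> v"
  shows "measure D A \<le> B * v"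
proof -
  have "emeasure D A \<le> ennreal (B * v)"
    using upper[OF assms(1)] assms B by (simp add: ennreal_mult)
  then show ?thesis
    using B assms(3) by (simp add: measure_def enn2real_leI)
qed

lemma cell_prob_le: "0 < s \<Longrightarrow> measure D (cell s z) \<le> B * s ^ CARD('d)"
  by (rule measure_D_le) (auto simp: emeasure_cell)

definition cball_const :: real where
  "cball_const = B * unit_ball_vol CARD('d)"

lemma cball_const_nonneg: "0 \<le> cball_const"
  using B by (simp add: cball_const_def unit_ball_vol_nonneg)

lemma cball_prob_le:
  assumes "0 \<le> \<rho>"
  shows "measure D (cball c \<rho>) \<le> cball_const * \<rho> ^ CARD('d)"
proof -
  have "measure D (cball c \<rho>) \<le> B * (unit_ball_vol (real CARD('d)) * \<rho> ^ CARD('d))"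
    by (rule measure_D_le) (use assms in \<open>auto simp: emeasure_cball\<close>)
  then show ?thesis by (simp add: cball_const_def mult.assoc)
qed

text \<open>
  The coefficient field occurs in no other argument and is therefore passed as a type.
\<close>

abbreviation trivial_at :: "'f::field itself \<Rightarrow> nat \<Rightarrow> real \<Rightarrow> nat \<Rightarrow> 'w \<Rightarrow> bool" where
  "trivial_at F n r k \<omega> \<equiv> trivial_group (simplicial_homology (cech_complex ((\<lambda>i. x i \<omega>) ` {..<n}) r) k
     :: ((real ^ 'd) list \<Rightarrow> 'f) set monoid)"

lemma trivial_at_events: "{\<omega> \<in> space M. trivial_at TYPE('f::field) n r k \<omega>} \<in> events"
  by (rule sets_trivial_homology) (rule rv)

lemma nontrivial_at_events: "{\<omega> \<in> space M. \<not> trivial_at TYPE('f::field) n r k \<omega>} \<in> events"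
  by (rule sets.sets_Collect_neg[OF trivial_at_events])

text \<open>
  Nonzero homology needs \<open>k + 2\<close> points within \<open>r\<close> of one of them. There are at most \<open>n\<^sup>k\<^sup>+\<^sup>2\<close> choices
  of indices, and given the position of the first point each of the other \<open>k + 1\<close> falls into a
  prescribed ball with probability at most a constant times \<open>r\<^sup>d\<close>.
\<close>

lemma prob_nontrivial_le:
  fixes r :: real
  assumes k: "1 \<le> k" and r: "0 < r"
  shows "prob {\<omega> \<in> space M. \<not> trivial_at TYPE('f::field) n r k \<omega>} \<le>
    real n ^ (k + 2) * (cball_const * ((CARD('d) + 1) * r) ^ CARD('d)) ^ (k + 1)"
proof -
  define \<tau> where "\<tau> = cball_const * ((CARD('d) + 1) * r) ^ CARD('d)"
  define R where "R z = cball (r *\<^sub>R corner z) ((CARD('d) + 1) * r)" for z :: "int ^ 'd"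
  define T where "T = {t \<in> {..<k + 2} \<rightarrow>\<^sub>E {..<n}. inj_on t {..<k + 2}}"
  define E where "E t = {\<omega> \<in> space M. \<exists>z. x (t 0) \<omega> \<in> cell r z \<and> (\<forall>i\<in>t ` {1..<k + 2}. x i \<omega> \<in> R z)}" for t
  have tau0: "0 \<le> \<tau>" using cball_const_nonneg r by (simp add: \<tau>_def)
  have finT: "finite T" unfolding T_def by (rule finite_subset[of _ "{..<k + 2} \<rightarrow>\<^sub>E {..<n}"]) (auto intro: finite_PiE)
  have cardT: "card T \<le> n ^ (k + 2)"
  proof -
    have "card T \<le> card ({..<k + 2} \<rightarrow>\<^sub>E {..<n})"
      unfolding T_def by (intro card_mono) (auto intro: finite_PiE)
    then show ?thesis by (simp add: card_PiE)
  qed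
  have Em: "E t \<in> events" for t
  proof -
    have "E t = (\<Union>z. {\<omega> \<in> space M. x (t 0) \<omega> \<in> cell r z} \<inter> {\<omega> \<in> space M. \<forall>i\<in>t ` {1..<k + 2}. x i \<omega> \<in> R z})"
      by (auto simp: E_def)
    moreover have ev: "{\<omega> \<in> space M. x i \<omega> \<in> A} \<in> events" if [measurable]: "A \<in> sets borel" for i A
      by measurable
    have "{\<omega> \<in> space M. x (t 0) \<omega> \<in> cell r z} \<inter> {\<omega> \<in> space M. \<forall>i\<in>t ` {1..<k + 2}. x i \<omega> \<in> R z} \<in> events" for z
      by (intro sets.Int sets.sets_Collect_finite_All ev) (auto simp: R_def)
    ultimately show ?thesis by simp
  qed
  have E: "prob (E t) \<le> \<tau> ^ (k + 1)" if t: "t \<in> T" for t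
  proof -
    have inj: "inj_on t {..<k + 2}" using t by (simp add: T_def)
    have "{1..<k + 2} \<subseteq> {..<k + 2}" by auto
    then have "card (t ` {1..<k + 2}) = k + 1" using card_image[OF inj_on_subset[OF inj]] by simp
    moreover have "prob (E t) \<le> \<tau> ^ card (t ` {1..<k + 2})"
      unfolding E_def
    proof (rule crowding_bound)
      show "measure D (R z) \<le> \<tau>" for z
        unfolding R_def \<tau>_def using r by (intro cball_prob_le) simp
      show "t 0 \<notin> t ` {1..<k + 2}" using inj_onD[OF inj, of 0] by fastforce
      show "disjoint_family (cell r :: int ^ 'd \<Rightarrow> _)"
        using cell_disjoint by (auto simp: disjoint_family_on_def)
    qed (auto simp: R_def)
    ultimately show ?thesis by simp
  qed
  have sub: "{\<omega> \<in> space M. \<not> trivial_at TYPE('f) n r k \<omega>} \<subseteq> (\<Union>t\<in>T. E t)"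
  proof
    fix \<omega> assume "\<omega> \<in> {\<omega> \<in> space M. \<not> trivial_at TYPE('f) n r k \<omega>}"
    then have \<omega>: "\<omega> \<in> space M" "\<not> trivial_at TYPE('f) n r k \<omega>" by auto
    obtain xs where xs: "distinct xs" "length xs = k + 2" "set xs \<subseteq> (\<lambda>i. x i \<omega>) ` {..<n}"
      "\<And>p. p \<in> set xs \<Longrightarrow> dist p (hd xs) \<le> r"
      using nontrivial_homology_crowded[OF k \<omega>(2)] by blast
    have "\<exists>i<n. x i \<omega> = xs ! j" if "j < k + 2" for j
    proof -
      have "xs ! j \<in> (\<lambda>i. x i \<omega>) ` {..<n}" using xs(2) that by (intro subsetD[OF xs(3)] nth_mem) simp
      then show ?thesis by auto
    qed
    then obtain t0 where t0: "\<And>j. j < k + 2 \<Longrightarrow> t0 j < n" "\<And>j. j < k + 2 \<Longrightarrow> x (t0 j) \<omega> = xs ! j" by metis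
    define t where "t = restrict t0 {..<k + 2}"
    have t: "t j < n" "x (t j) \<omega> = xs ! j" if "j < k + 2" for j using t0 that by (auto simp: t_def)
    have "inj_on t {..<k + 2}"
    proof (rule inj_onI)
      fix i j assume ij: "i \<in> {..<k + 2}" "j \<in> {..<k + 2}" "t i = t j"
      then have "xs ! i = xs ! j" using t(2)[of i] t(2)[of j] by simp
      then show "i = j" using ij xs(1,2) by (simp add: nth_eq_iff_index_eq)
    qed
    moreover have "t \<in> {..<k + 2} \<rightarrow>\<^sub>E {..<n}" using t0(1) by (auto simp: t_def)
    ultimately have tT: "t \<in> T" by (simp add: T_def)
    obtain z where z: "x (t 0) \<omega> \<in> cell r z" using in_some_cell by blast
    have hd: "hd xs = x (t 0) \<omega>" using t(2)[of 0] xs(2) hd_conv_nth[of xs] by (cases xs) auto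
    have "x i \<omega> \<in> R z" if i: "i \<in> t ` {1..<k + 2}" for i
    proof -
      obtain j where j: "j < k + 2" "i = t j" using i by auto
      have "dist (x i \<omega>) (x (t 0) \<omega>) \<le> r"
        unfolding j(2) t(2)[OF j(1)] hd[symmetric] using xs(2) j(1) by (intro xs(4)) simp
      then have "dist (x i \<omega>) (r *\<^sub>R corner z) \<le> r + r * CARD('d)"
        using dist_corner[OF r z] dist_triangle[of "x i \<omega>" "r *\<^sub>R corner z" "x (t 0) \<omega>"] by linarith
      then show ?thesis by (simp add: R_def dist_commute algebra_simps)
    qed
    then show "\<omega> \<in> (\<Union>t\<in>T. E t)" using z tT \<omega>(1) by (auto simp: E_def)
  qed
  have "prob {\<omega> \<in> space M. \<not> trivial_at TYPE('f) n r k \<omega>} \<le> prob (\<Union>t\<in>T. E t)"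
    by (intro finite_measure_mono sub sets.finite_UN finT Em)
  also have "\<dots> \<le> (\<Sum>t\<in>T. prob (E t))" by (rule measure_UNION_le[OF finT Em])
  also have "\<dots> \<le> (\<Sum>t\<in>T. \<tau> ^ (k + 1))" by (intro sum_mono E)
  also have "\<dots> = card T * \<tau> ^ (k + 1)" by simp
  also have "\<dots> \<le> real n ^ (k + 2) * \<tau> ^ (k + 1)"
  proof (rule mult_right_mono)
    show "real (card T) \<le> real n ^ (k + 2)" using cardT by (metis of_nat_le_iff of_nat_power)
  qed (use tau0 in simp)
  finally show ?thesis unfolding \<tau>_def .
qed

text \<open>
  The vertices of the stable hollow simplex, scaled by \<open>r\<close>, are rounded to lattice cells of side
  \<open>s = r / L\<close>, with \<open>L\<close> so large that any choice of points in these cells is still hollow. A set \<open>S\<close>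
  on which the density is at least \<open>\<epsilon>\<close> fills half of the required cells at order \<open>s\<^sup>-\<^sup>d\<close> positions
  \<open>z\<close>, so the expected number of patterns is at least of order \<open>n\<^sup>k\<^sup>+\<^sup>2 r\<^sup>d\<^sup>(\<^sup>k\<^sup>+\<^sup>1\<^sup>)\<close>. The region \<open>R z\<close> is a
  ball that contains everything within \<open>r\<close> of the vertex \<open>v 1\<close>.
\<close>

lemma prob_nontrivial_ge:
  assumes k: "k + 1 \<le> CARD('d)"
    and lower: "0 < \<epsilon>" "S \<in> lmeasurable" "0 < measure lebesgue S"
      "\<And>A. A \<in> sets borel \<Longrightarrow> ennreal \<epsilon> * emeasure lebesgue (A \<inter> S) \<le> emeasure D A"
  obtains c C r0 :: real where "0 < c" "0 \<le> C" "0 < r0"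
    "\<And>(n::nat) r::real. k + 2 \<le> n \<Longrightarrow> 0 < r \<Longrightarrow> r < r0 \<Longrightarrow> C * (n * r ^ CARD('d)) \<le> 1 \<Longrightarrow>
      1 - c / (real n ^ (k + 2) * (r ^ CARD('d)) ^ (k + 1)) - C * (n * r ^ CARD('d)) \<le>
      prob {\<omega> \<in> space M. \<not> trivial_at TYPE('f::field) n r k \<omega>}"
proof -
  let ?d = "CARD('d)"
  define N where "N = k + 2"
  obtain u :: "nat \<Rightarrow> real ^ 'd" and \<eta> where \<eta>: "0 < \<eta>" and
    hollow: "\<And>s z v. 0 < s \<Longrightarrow> (\<And>i. i \<le> k + 1 \<Longrightarrow> dist (v i) (z + s *\<^sub>R u i) \<le> s * \<eta>) \<Longrightarrow>
      \<not> (\<exists>c. \<forall>i\<le>k + 1. dist (v i) c \<le> s / 2) \<and>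
      (\<forall>j\<le>k + 1. \<exists>c. \<forall>i\<le>k + 1. i \<noteq> j \<longrightarrow> dist (v i) c \<le> s / 2)"
    by (rule stable_hollow_simplex[OF _ k]) auto
  \<comment> \<open>rounding moves a vertex by at most \<open>s * ?d\<close>, and so does the freedom within a cell\<close>
  define L where "L = 2 * ?d / \<eta>"
  have L: "0 < L" "L * \<eta> = 2 * ?d" using \<eta> by (auto simp: L_def)
  have "\<forall>i. \<exists>z. L *\<^sub>R u i \<in> cell 1 z" using in_some_cell by blast
  then obtain a :: "nat \<Rightarrow> int ^ 'd" where a: "\<And>i. L *\<^sub>R u i \<in> cell 1 (a i)"
    by metis
  obtain \<gamma> s0 :: real where \<gamma>: "0 < \<gamma>" "0 < s0" and full:
    "\<And>s::real. 0 < s \<Longrightarrow> s < s0 \<Longrightarrow> \<exists>Z. finite Z \<and> \<gamma> \<le> card Z * s ^ ?d \<and>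
       (\<forall>z\<in>Z. \<forall>j<N. s ^ ?d / 2 \<le> measure lebesgue (cell s (z + a j) \<inter> S))"
    using many_full_cells[OF lower(2,3)] by metis
  define \<rho> where "\<rho> = 1 + \<eta> + norm (u 1)"
  have \<rho>: "0 \<le> \<rho>" using \<eta> by (simp add: \<rho>_def)
  define C where "C = B / L ^ ?d + 2 * cball_const * \<rho> ^ ?d"
  define c0 where "c0 = \<gamma> * (\<epsilon> / (4 * N)) ^ N / L ^ (?d * (k + 1))"
  have c0: "0 < c0" using \<gamma> lower(1) L by (simp add: c0_def N_def)
  show thesis
  proof (rule that[of "4 * 2 ^ N / c0" C "s0 * L"])
    show "0 < 4 * 2 ^ N / c0" "0 < s0 * L" using c0 \<gamma> L by simp_all
    show "0 \<le> C" using B L \<rho> cball_const_nonneg by (simp add: C_def)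
    fix n :: nat and r :: real
    assume n: "k + 2 \<le> n" and r: "0 < r" "r < s0 * L" and sparse: "C * (n * r ^ ?d) \<le> 1"
    define s where "s = r / L"
    have s: "0 < s" "s < s0" "s * L = r" using r L by (auto simp: s_def field_simps)
    obtain Z where Z: "finite Z" "\<gamma> \<le> card Z * s ^ ?d"
      "\<And>z j. z \<in> Z \<Longrightarrow> j < N \<Longrightarrow> s ^ ?d / 2 \<le> measure lebesgue (cell s (z + a j) \<inter> S)"
      using full[OF s(1,2)] by metis
    \<comment> \<open>the indices below \<open>N * m\<close> are cut into \<open>N\<close> blocks of equal size, at the cost of a constant factor\<close>
    define m where "m = n div N"
    have m: "N * m \<le> n" "real n / (2 * N) \<le> m"
    proof -
      show "N * m \<le> n" by (simp add: m_def)
      have "n < N * m + N" using dividend_less_div_times[of N n] by (simp add: m_def N_def mult.commute)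
      moreover have "1 \<le> m" unfolding m_def N_def using n by (simp add: Suc_le_eq div_greater_zero_iff)
      ultimately have "n \<le> 2 * (N * m)" using mult_le_mono2[of 1 m N] by linarith
      then have "real n \<le> 2 * (real N * real m)" by (metis of_nat_le_iff of_nat_mult of_nat_numeral)
      then show "real n / (2 * N) \<le> m" by (simp add: N_def field_simps)
    qed
    define K where "K j = {j * m..<j * m + m}" for j
    have Kn: "K j \<subseteq> {..<n}" if "j < N" for j
    proof -
      have "j * m + m \<le> N * m" using mult_le_mono1[of "j + 1" N m] that by simp
      then show ?thesis using m(1) by (auto simp: K_def)
    qed
    have Kdisj: "disjoint_family_on K {..<N}"
    proof -
      have "K i \<inter> K j = {}" if "i < j" for i j
        using mult_le_mono1[of "i + 1" j m] that by (auto simp: K_def)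
      then show ?thesis unfolding disjoint_family_on_def by (metis inf_commute linorder_neqE_nat)
    qed
    define A where "A z j = cell s (z + a j)" for z j
    define R where "R z = cball (s *\<^sub>R corner z) (\<rho> * r)" for z :: "int ^ 'd"
    define \<tau> where "\<tau> = cball_const * (\<rho> * r) ^ ?d"
    define \<mu> where "\<mu> = (\<Sum>z\<in>Z. \<Prod>j<N. real m * measure D (A z j))"
    have rs: "s ^ ?d = r ^ ?d / L ^ ?d" by (simp add: s_def power_divide)
    have Dlow: "\<epsilon> * (s ^ ?d / 2) \<le> measure D (A z j)" if "z \<in> Z" "j < N" for z j
    proof -
      interpret D: prob_space D by (rule prob_space_D)
      have "cell s (z + a j) \<inter> S \<in> lmeasurable"
        by (rule fmeasurable_Int_fmeasurable[OF cell_lmeasurable[OF s(1)]]) (use lower(2) in auto)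
      then have "ennreal (\<epsilon> * measure lebesgue (cell s (z + a j) \<inter> S)) \<le> emeasure D (A z j)"
        using lower(4)[of "cell s (z + a j)"] lower(1) by (simp add: A_def ennreal_mult emeasure_eq_measure2)
      then have "\<epsilon> * measure lebesgue (cell s (z + a j) \<inter> S) \<le> measure D (A z j)"
        using D.emeasure_eq_measure by simp
      moreover have "\<epsilon> * (s ^ ?d / 2) \<le> \<epsilon> * measure lebesgue (cell s (z + a j) \<inter> S)"
        using Z(3)[OF that] lower(1) by simp
      ultimately show ?thesis by linarith
    qed
    have mu_ge: "c0 * (real n ^ (k + 2) * (r ^ ?d) ^ (k + 1)) \<le> \<mu>"
    proof -
      define v where "v = s ^ ?d"
      have v: "0 < v" using s by (simp add: v_def)
      define q where "q = real n / (2 * N) * (\<epsilon> * (v / 2))"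
      have q0: "0 \<le> q" using v lower(1) by (simp add: q_def)
      have "q \<le> real m * measure D (A z j)" if "z \<in> Z" "j < N" for z j
        unfolding q_def v_def using Dlow[OF that] m(2) s lower(1) by (intro mult_mono) auto
      then have "(\<Sum>z\<in>Z. \<Prod>j<N. q) \<le> \<mu>"
        unfolding \<mu>_def by (intro sum_mono prod_mono) (use q0 in auto)
      then have "card Z * q ^ N \<le> \<mu>" by simp
      moreover have "card Z * q ^ N = (card Z * v) * ((real n * (\<epsilon> / (4 * N))) ^ N * v ^ (k + 1))"
      proof -
        have q: "q = real n * (\<epsilon> / (4 * N)) * v" by (simp add: q_def)
        have qN: "q ^ N = (real n * (\<epsilon> / (4 * N))) ^ N * v ^ N" unfolding q by (rule power_mult_distrib)
        have vN: "v ^ N = v * v ^ (k + 1)" by (simp add: N_def)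
        show ?thesis unfolding qN vN by (simp only: mult_ac)
      qed
      moreover have "\<gamma> * ((real n * (\<epsilon> / (4 * N))) ^ N * v ^ (k + 1)) \<le> (card Z * v) * ((real n * (\<epsilon> / (4 * N))) ^ N * v ^ (k + 1))"
        using Z(2) lower(1) v by (intro mult_right_mono) (auto simp: v_def)
      moreover have "\<gamma> * ((real n * (\<epsilon> / (4 * N))) ^ N * v ^ (k + 1)) = c0 * (real n ^ (k + 2) * (r ^ ?d) ^ (k + 1))"
      proof -
        have vk: "v ^ (k + 1) = (r ^ ?d) ^ (k + 1) / L ^ (?d * (k + 1))"
          unfolding v_def rs by (simp only: power_divide power_mult)
        have nN: "(real n * (\<epsilon> / (4 * N))) ^ N = real n ^ (k + 2) * (\<epsilon> / (4 * N)) ^ N"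
          by (simp only: power_mult_distrib N_def)
        show ?thesis
          unfolding vk nN c0_def by (simp only: times_divide_eq_left times_divide_eq_right mult_ac)
      qed
      ultimately show ?thesis by linarith
    qed
    have n0: "0 < real n ^ (k + 2) * (r ^ ?d) ^ (k + 1)" using n r by simp
    then have mu0: "0 < \<mu>" using mu_ge c0 by (meson less_le_trans mult_pos_pos)
    have Ct: "C * (n * r ^ ?d) = n * (B * s ^ ?d) + 2 * (n * \<tau>)"
      by (simp add: C_def \<tau>_def rs power_mult_distrib algebra_simps)
    have tau0: "0 \<le> \<tau>" using cball_const_nonneg \<rho> r by (simp add: \<tau>_def)
    let ?S = "{\<omega> \<in> space M. \<exists>z\<in>Z. \<exists>t\<in>Pi\<^sub>E {..<N} K. (\<forall>j<N. x (t j) \<omega> \<in> A z j) \<and>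
      (\<forall>i<n. i \<notin> t ` {..<N} \<longrightarrow> x i \<omega> \<notin> R z)}"
    have prob_S: "prob ?S \<ge> 1 - 4 * 2 ^ N / \<mu> - 2 * (n * \<tau>)"
    proof (rule isolated_pattern_likely[OF Z(1) Kn Kdisj, where m=m])
      show "A z j \<inter> A z' j = {}" if "z \<noteq> z'" for z z' j
        unfolding A_def using that by (intro cell_disjoint) simp
      show "real m * measure D (A z j) \<le> 1" if "z \<in> Z" "j < N" for z j
      proof -
        have "real m \<le> real n" unfolding m_def by simp
        then have "real m * measure D (A z j) \<le> n * (B * s ^ ?d)"
          unfolding A_def by (intro mult_mono cell_prob_le s) auto
        also have "\<dots> \<le> C * (n * r ^ ?d)" using tau0 by (simp add: Ct)
        finally show ?thesis using sparse by linarith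
      qed
      show "measure D (R z) \<le> \<tau>" for z
        unfolding R_def \<tau>_def using r \<rho> by (intro cball_prob_le) simp
    qed (use mu0 in \<open>auto simp: K_def A_def R_def \<mu>_def N_def\<close>)
    have "?S \<subseteq> {\<omega> \<in> space M. \<not> trivial_at TYPE('f) n r k \<omega>}"
    proof
      fix \<omega> assume "\<omega> \<in> ?S"
      then obtain z t where \<omega>: "\<omega> \<in> space M" and zt: "z \<in> Z" "t \<in> Pi\<^sub>E {..<N} K"
        "\<And>j. j < N \<Longrightarrow> x (t j) \<omega> \<in> A z j" "\<And>i. i < n \<Longrightarrow> i \<notin> t ` {..<N} \<Longrightarrow> x i \<omega> \<notin> R z"
        by blast
      define v where "v j = x (t j) \<omega>" for j
      have near: "dist (v j) (s *\<^sub>R corner z + r *\<^sub>R u j) \<le> r * \<eta>" if "j \<le> k + 1" for j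
      proof -
        have "dist (v j) (s *\<^sub>R corner (z + a j)) \<le> s * ?d"
          using zt(3)[of j] that s by (intro dist_corner) (auto simp: v_def A_def N_def)
        moreover have "dist (s *\<^sub>R corner (z + a j)) (s *\<^sub>R corner z + r *\<^sub>R u j) \<le> s * ?d"
        proof -
          have "dist (L *\<^sub>R u j) (corner (a j)) \<le> ?d" using dist_corner[OF _ a[of j]] by simp
          moreover have "s *\<^sub>R corner (z + a j) - (s *\<^sub>R corner z + r *\<^sub>R u j) = s *\<^sub>R (corner (a j) - L *\<^sub>R u j)"
            using s(3) by (simp add: corner_add scaleR_add_right scaleR_diff_right)
          then have "dist (s *\<^sub>R corner (z + a j)) (s *\<^sub>R corner z + r *\<^sub>R u j) = s * dist (corner (a j)) (L *\<^sub>R u j)"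
            using s(1) by (simp add: dist_norm)
          ultimately show ?thesis using s(1) by (simp add: dist_commute)
        qed
        ultimately have "dist (v j) (s *\<^sub>R corner z + r *\<^sub>R u j) \<le> s * ?d + s * ?d"
          using dist_triangle[of "v j" "s *\<^sub>R corner z + r *\<^sub>R u j" "s *\<^sub>R corner (z + a j)"] by linarith
        also have "\<dots> = s * (L * \<eta>)" unfolding L(2) by (simp add: algebra_simps)
        also have "\<dots> = r * \<eta>" using s(3) by simp
        finally show ?thesis .
      qed
      note hollow' = hollow[OF r(1) near]
      have "\<not> trivial_at TYPE('f) n r k \<omega>"
      proof (rule isolated_hollow_simplex_homology[of _ v])
        show "v ` {..k + 1} \<subseteq> (\<lambda>i. x i \<omega>) ` {..<n}"
        proof
          fix p assume "p \<in> v ` {..k + 1}"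
          then obtain j where "j \<le> k + 1" "p = v j" by auto
          then have j: "j < N" "p = x (t j) \<omega>" by (auto simp: v_def N_def)
          then have "t j < n" using Kn PiE_mem[OF zt(2), of j] by auto
          then show "p \<in> (\<lambda>i. x i \<omega>) ` {..<n}" using j by auto
        qed
        show "\<exists>c. \<forall>i\<le>k + 1. i \<noteq> j \<longrightarrow> dist (v i) c \<le> r / 2" if "j \<le> k + 1" for j
          using hollow' that by blast
        show "\<not> (\<exists>c. \<forall>i\<le>k + 1. dist (v i) c \<le> r / 2)" using hollow' by blast
        fix p assume p: "p \<in> (\<lambda>i. x i \<omega>) ` {..<n}" "dist p (v 1) \<le> r"
        then obtain i where i: "i < n" "p = x i \<omega>" by auto
        have "dist (s *\<^sub>R corner z + r *\<^sub>R u 1) (s *\<^sub>R corner z) = r * norm (u 1)"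
          using r by (simp add: dist_norm)
        then have "dist p (s *\<^sub>R corner z) \<le> r + r * \<eta> + r * norm (u 1)"
          using p(2) near[of 1] dist_triangle[of p "s *\<^sub>R corner z" "v 1"]
            dist_triangle[of "v 1" "s *\<^sub>R corner z" "s *\<^sub>R corner z + r *\<^sub>R u 1"] by simp
        then have "p \<in> R z" by (simp add: R_def \<rho>_def dist_commute algebra_simps)
        then have "i \<in> t ` {..<N}" using zt(4)[OF i(1)] i(2) by blast
        then show "p \<in> v ` {..k + 1}" using i(2) by (auto simp: v_def N_def less_Suc_eq_le)
      qed auto
      then show "\<omega> \<in> {\<omega> \<in> space M. \<not> trivial_at TYPE('f) n r k \<omega>}" using \<omega> by simp
    qed
    then have "prob ?S \<le> prob {\<omega> \<in> space M. \<not> trivial_at TYPE('f) n r k \<omega>}"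
      by (intro finite_measure_mono nontrivial_at_events)
    moreover have "4 * 2 ^ N / \<mu> \<le> 4 * 2 ^ N / c0 / (real n ^ (k + 2) * (r ^ ?d) ^ (k + 1))"
    proof -
      have "4 * 2 ^ N / \<mu> \<le> 4 * 2 ^ N / (c0 * (real n ^ (k + 2) * (r ^ ?d) ^ (k + 1)))"
        using mu_ge mu0 mult_pos_pos[OF c0 n0] by (intro divide_left_mono) auto
      then show ?thesis by simp
    qed
    moreover have "2 * (n * \<tau>) \<le> C * (n * r ^ ?d)" using B s by (simp add: Ct)
    ultimately show "1 - 4 * 2 ^ N / c0 / (real n ^ (k + 2) * (r ^ ?d) ^ (k + 1)) - C * (n * r ^ ?d) \<le>
      prob {\<omega> \<in> space M. \<not> trivial_at TYPE('f) n r k \<omega>}"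
      using prob_S by linarith
  qed
qed

end

section \<open>The threshold\<close>

text \<open>
  Clears the fractional exponent from \<open>r / n\<^sup>-\<^sup>a\<^sup>/\<^sup>b\<close>, so that the threshold becomes a statement about
  the monomial \<open>n\<^sup>a r\<^sup>b\<close>.
\<close>

lemma scaled_power:
  assumes "0 < n"
  shows "(r / real n powr - (real a / real b)) ^ b = (if b = 0 then 1 else real n ^ a * r ^ b)"
proof (cases "b = 0")
  case False
  have "(real n powr - (real a / real b)) ^ b = real n powr (- (real a / real b) * real b)"
    using assms by (simp add: powr_powr flip: powr_realpow)
  also have "- (real a / real b) * real b = - real a" using False by simp
  also have "real n powr - real a = 1 / real n ^ a"
    using assms by (simp add: powr_minus powr_realpow divide_inverse)
  finally show ?thesis using False assms by (simp add: power_divide)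
qed simp

lemma smallo_scaled_power:
  assumes "r \<in> o(\<lambda>n. real n powr - (real a / real b))" "0 < b"
  shows "(\<lambda>n. real n ^ a * r n ^ b) \<longlonglongrightarrow> 0"
proof -
  have "(\<lambda>n. (r n / real n powr - (real a / real b)) ^ b) \<longlonglongrightarrow> 0 ^ b"
    by (intro tendsto_power smalloD_tendsto assms(1))
  moreover have "\<forall>\<^sub>F n in sequentially. (r n / real n powr - (real a / real b)) ^ b = real n ^ a * r n ^ b"
    using eventually_gt_at_top[of 0] by eventually_elim (use assms(2) scaled_power in auto)
  ultimately show ?thesis using assms(2) by (simp add: filterlim_cong zero_power)
qed

lemma smallomega_scaled_power:
  assumes "r \<in> \<omega>(\<lambda>n. real n powr - (real a / real b))" "0 < b" "\<And>n. 0 < r n"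
  shows "filterlim (\<lambda>n. real n ^ a * r n ^ b) at_top sequentially"
proof -
  let ?g = "\<lambda>n::nat. real n powr - (real a / real b)"
  have ev: "\<forall>\<^sub>F n in sequentially. ?g n \<noteq> 0"
    using eventually_gt_at_top[of 0] by eventually_elim simp
  have "filterlim (\<lambda>n. norm (r n / ?g n)) at_top sequentially"
    by (rule smallomegaD_filterlim_at_top_norm[OF assms(1) ev])
  then have "filterlim (\<lambda>n. norm (r n / ?g n) ^ b) at_top sequentially"
    by (rule filterlim_pow_at_top[OF assms(2)])
  moreover have "\<forall>\<^sub>F n in sequentially. norm (r n / ?g n) ^ b = real n ^ a * r n ^ b"
    using eventually_gt_at_top[of 0]
  proof eventually_elim
    case (elim n)
    have nrm: "norm (r n / ?g n) = r n / ?g n" using assms(3)[of n] by simp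
    show ?case unfolding nrm using scaled_power[OF elim, of "r n" a b] assms(2) by simp
  qed
  ultimately show ?thesis by (simp add: filterlim_cong)
qed

theorem theorem3p10:
  fixes M :: "'w measure"
    and x :: "nat \<Rightarrow> 'w \<Rightarrow> real ^ 'd"
    and f :: "real ^ 'd \<Rightarrow> real"
    and r :: "nat \<Rightarrow> real"
    and k :: nat
  assumes d_ge_2: "CARD('d) \<ge> 2"
    and k_ge_1: "k \<ge> 1"
    and prob: "prob_space M"
    and f_nonneg: "\<And>p. 0 \<le> f p"
    and f_bounded: "bounded (range f)"
    and f_total: "integrable lebesgue f" "integral\<^sup>L lebesgue f = 1"
    and density: "\<And>i. has_lebesgue_density M (x i) f"
    and indep: "prob_space.indep_vars M (\<lambda>_. borel) x UNIV"
    and r_pos: "\<And>n. 0 < r n"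
    and r_sparse: "r \<in> o(\<lambda>n. real n powr (- (1 / real CARD('d))))"
  shows
    "(r \<in> o(\<lambda>n. real n powr (- ((real k + 2) / (real CARD('d) * (real k + 1))))) \<longrightarrow>
        aas M (\<lambda>n \<omega>. trivial_group
          (simplicial_homology (cech_complex ((\<lambda>i. x i \<omega>) ` {..<n}) (r n)) k
             :: ((real ^ 'd) list \<Rightarrow> 'f::field) set monoid)))
     \<and>
     (k \<le> CARD('d) - 1 \<longrightarrow>
      r \<in> \<omega>(\<lambda>n. real n powr (- ((real k + 2) / (real CARD('d) * (real k + 1))))) \<longrightarrow>
        aas M (\<lambda>n \<omega>. \<not> trivial_group
          (simplicial_homology (cech_complex ((\<lambda>i. x i \<omega>) ` {..<n}) (r n)) k
             :: ((real ^ 'd) list \<Rightarrow> 'f::field) set monoid)))"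
proof -
  let ?d = "CARD('d)"
  define D where "D = distr M borel (x 0)"
  have fm: "f \<in> borel_measurable lebesgue" using f_total(1) by auto
  have D: "emeasure D A = emeasure (density lebesgue f) A" if "A \<in> sets borel" for A
    using density[of 0] that by (simp add: has_lebesgue_density_def D_def)
  have law: "distr M borel (x i) = D" for i
  proof (rule measure_eqI)
    fix A assume "A \<in> sets (distr M borel (x i))"
    then show "emeasure (distr M borel (x i)) A = emeasure D A"
      using density[of i] D by (simp add: has_lebesgue_density_def)
  qed (simp add: D_def)
  obtain B where B: "\<And>p. \<bar>f p\<bar> \<le> B" using f_bounded by (auto simp: bounded_iff)
  have B0: "0 \<le> B" using B[of 0] by linarith
  interpret prob_space M by (rule prob)
  interpret bounded_iid_points M x D B
  proof
    show "indep_vars (\<lambda>_. borel) x UNIV" by (rule indep)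
    fix A :: "(real ^ 'd) set" assume A: "A \<in> sets borel"
    have "emeasure D A \<le> ennreal B * emeasure lebesgue A"
      unfolding D[OF A]
    proof (rule emeasure_density_le)
      show "ennreal (f p) \<le> ennreal B" for p using B[of p] by (intro ennreal_leI) simp
    qed (use fm A in auto)
    then show "emeasure D A \<le> ennreal B * emeasure lborel A" using A by simp
  qed (use law B0 in auto)
  have exponent: "(real k + 2) / (real ?d * (real k + 1)) = real (k + 2) / real (?d * (k + 1))" by (simp add: algebra_simps)
  have power: "real n ^ a * r n ^ (?d * (k + 1)) = real n ^ a * (r n ^ ?d) ^ (k + 1)" for n a
    by (simp only: power_mult)
  have pos: "0 < ?d * (k + 1)" using d_ge_2 by simp
  let ?T = "trivial_at TYPE('f)"
  show ?thesis
  proof (intro conjI impI)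
    assume "r \<in> o(\<lambda>n. real n powr (- ((real k + 2) / (real ?d * (real k + 1)))))"
    then have lim: "(\<lambda>n. real n ^ (k + 2) * (r n ^ ?d) ^ (k + 1)) \<longlonglongrightarrow> 0"
      using smallo_scaled_power[OF _ pos, of r "k + 2"] unfolding exponent power by blast
    define C where "C = (cball_const * real (?d + 1) ^ ?d) ^ (k + 1)"
    have le: "prob {\<omega> \<in> space M. \<not> ?T n (r n) k \<omega>} \<le> C * (real n ^ (k + 2) * (r n ^ ?d) ^ (k + 1))" for n
      using prob_nontrivial_le[OF k_ge_1 r_pos[of n], of n, where 'f='f]
      by (simp add: C_def power_mult_distrib mult_ac add_ac)
    have "(\<lambda>n. prob {\<omega> \<in> space M. ?T n (r n) k \<omega>}) \<longlonglongrightarrow> 1"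
    proof (rule tendsto_sandwich[OF _ _ _ tendsto_const])
      show "(\<lambda>n. 1 - C * (real n ^ (k + 2) * (r n ^ ?d) ^ (k + 1))) \<longlonglongrightarrow> 1"
        by (rule tendsto_eq_intros lim refl)+ simp
      have "1 - C * (real n ^ (k + 2) * (r n ^ ?d) ^ (k + 1)) \<le> prob {\<omega> \<in> space M. ?T n (r n) k \<omega>}" for n
        using le[of n] prob_neg[OF trivial_at_events[of n "r n" k, where 'f='f]] by linarith
      then show "\<forall>\<^sub>F n in sequentially. 1 - C * (real n ^ (k + 2) * (r n ^ ?d) ^ (k + 1)) \<le> prob {\<omega> \<in> space M. ?T n (r n) k \<omega>}"
        by simp
    qed simp
    then show "aas M (\<lambda>n \<omega>. ?T n (r n) k \<omega>)" by (simp add: aas_def)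
  next
    assume kd: "k \<le> ?d - 1" and "r \<in> \<omega>(\<lambda>n. real n powr (- ((real k + 2) / (real ?d * (real k + 1)))))"
    then have lim: "filterlim (\<lambda>n. real n ^ (k + 2) * (r n ^ ?d) ^ (k + 1)) at_top sequentially"
      using smallomega_scaled_power[where r=r and a="k + 2", OF _ pos r_pos] unfolding exponent power by blast
    have sparse: "(\<lambda>n. real n * r n ^ ?d) \<longlonglongrightarrow> 0"
      using smallo_scaled_power[of r 1 ?d] r_sparse d_ge_2 by simp
    \<comment> \<open>\<open>r\<close> is the product of \<open>r / n\<^sup>-\<^sup>1\<^sup>/\<^sup>d\<close> and \<open>n\<^sup>-\<^sup>1\<^sup>/\<^sup>d\<close>, and both factors tend to \<open>0\<close>\<close>
    have r0: "r \<longlonglongrightarrow> 0"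
    proof -
      have "(\<lambda>n::nat. real n powr (- (1 / real ?d))) \<longlonglongrightarrow> 0"
        by (intro tendsto_neg_powr filterlim_real_sequentially) (use d_ge_2 in simp)
      then show ?thesis
        using smalloD_tendsto[OF r_sparse] tendsto_mult[of "\<lambda>n. r n / real n powr (- (1 / real ?d))" 0 sequentially
            "\<lambda>n. real n powr (- (1 / real ?d))" 0]
          Lim_transform_eventually[of "\<lambda>n. r n / real n powr (- (1 / real ?d)) * real n powr (- (1 / real ?d))" 0 sequentially r]
          eventually_mono[OF eventually_gt_at_top[of 0], of "\<lambda>n. r n / real n powr (- (1 / real ?d)) * real n powr (- (1 / real ?d)) = r n"]
        by simp
    qed
    obtain \<epsilon> S where S: "0 < \<epsilon>" "S \<in> lmeasurable" "0 < measure lebesgue S" "\<And>p. p \<in> S \<Longrightarrow> \<epsilon> \<le> f p"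
      using density_level_set[OF f_nonneg f_total(1)] f_total(2) by auto
    have lower: "ennreal \<epsilon> * emeasure lebesgue (A \<inter> S) \<le> emeasure D A" if A: "A \<in> sets borel" for A
      unfolding D[OF A]
      by (rule emeasure_density_ge) (use fm A S in \<open>auto intro: ennreal_leI\<close>)
    have kd': "k + 1 \<le> ?d" using kd d_ge_2 by simp
    obtain c C r0' :: real where c: "0 < c" "0 \<le> C" "0 < r0'" and
      ge: "\<And>(n::nat) r::real. k + 2 \<le> n \<Longrightarrow> 0 < r \<Longrightarrow> r < r0' \<Longrightarrow> C * (n * r ^ ?d) \<le> 1 \<Longrightarrow>
        1 - c / (real n ^ (k + 2) * (r ^ ?d) ^ (k + 1)) - C * (n * r ^ ?d) \<le>
        prob {\<omega> \<in> space M. \<not> ?T n r k \<omega>}"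
    proof (rule prob_nontrivial_ge[OF kd' S(1-3), where 'f='f])
      show "ennreal \<epsilon> * emeasure lebesgue (A \<inter> S) \<le> emeasure D A" if "A \<in> sets borel" for A
        using that by (rule lower)
    qed (rule that)
    have "(\<lambda>n. prob {\<omega> \<in> space M. \<not> ?T n (r n) k \<omega>}) \<longlonglongrightarrow> 1"
    proof (rule tendsto_sandwich[OF _ _ _ tendsto_const])
      have "(\<lambda>n. c / (real n ^ (k + 2) * (r n ^ ?d) ^ (k + 1))) \<longlonglongrightarrow> 0"
        by (rule tendsto_divide_0[OF tendsto_const filterlim_at_top_imp_at_infinity[OF lim]])
      then have "(\<lambda>n. 1 - c / (real n ^ (k + 2) * (r n ^ ?d) ^ (k + 1)) - C * (n * r n ^ ?d)) \<longlonglongrightarrow> 1 - 0 - C * 0"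
        by (intro tendsto_intros sparse)
      then show "(\<lambda>n. 1 - c / (real n ^ (k + 2) * (r n ^ ?d) ^ (k + 1)) - C * (n * r n ^ ?d)) \<longlonglongrightarrow> 1" by simp
      have "(\<lambda>n. C * (n * r n ^ ?d)) \<longlonglongrightarrow> C * 0" by (intro tendsto_intros sparse)
      then have "\<forall>\<^sub>F n in sequentially. C * (n * r n ^ ?d) < 1" by (rule order_tendstoD) simp
      moreover have "\<forall>\<^sub>F n in sequentially. r n < r0'" by (rule order_tendstoD(2)[OF r0 c(3)])
      ultimately show "\<forall>\<^sub>F n in sequentially. 1 - c / (real n ^ (k + 2) * (r n ^ ?d) ^ (k + 1)) - C * (n * r n ^ ?d) \<le>
          prob {\<omega> \<in> space M. \<not> ?T n (r n) k \<omega>}"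
        using eventually_ge_at_top[of "k + 2"] by eventually_elim (use ge r_pos in force)
    qed simp
    then show "aas M (\<lambda>n \<omega>. \<not> ?T n (r n) k \<omega>)" by (simp add: aas_def)
  qed
qed

end
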